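(* Let $\mu$ be a non-negative Borel measure on the open unit disc $\mathbb{D}\subset\mathbb{C}$, and suppose that $$ \sup_{\lambda\in\operatorname{supp}\mu}\int_{\mathbb{D}}|k_\lambda(z)|^2\,d\mu(z)=:A<\infty, $$ where $k_\lambda(z)=\frac{(1-|\lambda|^2)^{1/2}}{1-z\overline{\lambda}}$ is the normalized reproducing kernel of $H^2(\mathbb{D})$ at $\lambda\in\mathbb{D}$. Then $$ \int_{\mathbb{D}}|f(z)|^2\,d\mu(z)\le 2e\,A\,\|f\|_{H^2(\mathbb{D})}^2\qquad\text{for all } f\in H^2(\mathbb{D}). $$
   Context: The Hardy space $H^2(\mathbb{D})$ is the closure of the analytic polynomials in $L^2(\mathbb{T},m)$, where $m$ is normalized ($m(\mathbb{T})=1$) Lebesgue measure on the unit circle $\mathbb{T}=\partial\mathbb{D}$, with the norm inherited from $L^2(\mathbb{T},m)$. Each $f\in H^2(\mathbb{D})$ is identified with its analytic extension to $\mathbb{D}$, so $f(z)$ makes sense for $z\in\mathbb{D}$. The support $\operatorname{supp}\mu$ is the closed support of $\mu$ in $\mathbb{D}$. *)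

theory Defs
  imports "HOL-Complex_Analysis.Complex_Analysis"
begin

text \<open>Elements of $L^2(\mathbb{T},m)$ are represented by measurable functions; only their values
  on the unit circle matter, and functions that agree almost everywhere are not identified.\<close>

definition circle_measure :: "complex measure" where
  "circle_measure =
     distr (restrict_space lborel {0..1}) (restrict_space borel (sphere 0 1)) (\<lambda>t. cis (2 * pi * t))"

definition L2_circle :: "(complex \<Rightarrow> complex) set" where
  "L2_circle = {g \<in> borel_measurable circle_measure. integrable circle_measure (\<lambda>w. (cmod (g w))\<^sup>2)}"

definition L2_circle_norm :: "(complex \<Rightarrow> complex) \<Rightarrow> real" where
  "L2_circle_norm g = sqrt (\<integral>w. (cmod (g w))\<^sup>2 \<partial>circle_measure)"

definition hardy_H2 :: "(complex \<Rightarrow> complex) set" where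
  "hardy_H2 = {g \<in> L2_circle. \<forall>\<epsilon>>0. \<exists>p. L2_circle_norm (\<lambda>w. g w - poly p w) < \<epsilon>}"

text \<open>The analytic extension to the unit disc is the Cauchy integral of the boundary function,
  \[ f(z) = \frac{1}{2\pi i}\int_{\mathbb{T}} \frac{g(w)}{w-z}\,dw
          = \int_{\mathbb{T}} \frac{g(w)}{1-z\overline{w}}\,dm(w), \]
  where \<open>w * cnj w = 1\<close> on the circle. It is the extension by continuity of evaluation of analytic
  polynomials at \<open>z\<close>, see \<open>analytic_extension_poly\<close> below.\<close>

definition analytic_extension :: "(complex \<Rightarrow> complex) \<Rightarrow> complex \<Rightarrow> complex" where
  "analytic_extension g z = (\<integral>w. g w / (1 - z * cnj w) \<partial>circle_measure)"

definition normalized_kernel :: "complex \<Rightarrow> complex \<Rightarrow> complex" where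
  "normalized_kernel l z = of_real (sqrt (1 - (cmod l)\<^sup>2)) / (1 - z * cnj l)"

text \<open>The closed support relative to the space of the measure, not its closure in the whole
  plane.\<close>

definition closed_support :: "'a::topological_space measure \<Rightarrow> 'a set" where
  "closed_support M = {x \<in> space M. \<forall>U. open U \<longrightarrow> x \<in> U \<longrightarrow> emeasure M (U \<inter> space M) > 0}"

lemma analytic_extension_poly:
  assumes "cmod z < 1"
  shows "analytic_extension (poly p) z = poly p z"
proof -
  let ?g = "\<lambda>t::real. cis (2 * pi * t)"
  let ?h = "\<lambda>w. poly p w / (1 - z * cnj w)"
  have circ: "circlepath 0 1 t = ?g t" for t
    by (simp add: circlepath cis_conv_exp algebra_simps)
  have nz: "?g t - z \<noteq> 0" "1 - z * cnj (?g t) \<noteq> 0" for t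
  proof -
    show "?g t - z \<noteq> 0" using assms by auto
    have "cmod (z * cnj (?g t)) < 1" using assms by (simp add: norm_mult)
    thus "1 - z * cnj (?g t) \<noteq> 0" by auto
  qed
  have unit: "?g t * cnj (?g t) = 1" for t
    by (simp add: cis_cnj cis_mult)
  have meas: "?g \<in> restrict_space lborel {0..1} \<rightarrow>\<^sub>M restrict_space borel (sphere 0 1)"
  proof (rule measurable_restrict_space2)
    show "?g \<in> borel_measurable (restrict_space lborel {0..1})"
      by (intro measurable_restrict_space1)
         (simp add: borel_measurable_continuous_onI continuous_intros)
  qed auto
  have hmeas: "?h \<in> borel_measurable (restrict_space borel (sphere 0 1))"
    by (intro measurable_restrict_space1 borel_measurable_divide borel_measurable_continuous_onI
              continuous_intros)
  have cont: "continuous_on {0..1} (\<lambda>t. ?h (?g t))"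
    by (intro continuous_intros) (use nz in auto)
  have "analytic_extension (poly p) z = (\<integral>t. ?h (?g t) \<partial>restrict_space lborel {0..1})"
    unfolding analytic_extension_def circle_measure_def by (rule integral_distr[OF meas hmeas])
  also have "\<dots> = (LINT t:{0..1}|lborel. ?h (?g t))"
    unfolding set_lebesgue_integral_def by (rule integral_restrict_space) simp
  also have "\<dots> = integral {0..1} (\<lambda>t. ?h (?g t))"
    by (intro set_borel_integral_eq_integral(2) borel_integrable_atLeastAtMost' cont)
  also have "\<dots> = poly p z"
  proof (rule integral_unique)
    have "((\<lambda>u. poly p u / (u - z)) has_contour_integral 2 * of_real pi * \<i> * poly p z)
        (circlepath 0 1)"
      by (rule Cauchy_integral_circlepath_simple)
         (use assms in \<open>auto intro!: holomorphic_intros\<close>)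
    hence "((\<lambda>t. poly p (?g t) / (?g t - z) * vector_derivative (circlepath 0 1) (at t within {0..1}))
             has_integral 2 * of_real pi * \<i> * poly p z) {0..1}"
      unfolding has_contour_integral_def circ .
    hence "((\<lambda>t. 2 * of_real pi * \<i> * ?h (?g t)) has_integral 2 * of_real pi * \<i> * poly p z) {0..1}"
    proof (rule has_integral_eq[rotated])
      fix t :: real assume t: "t \<in> {0..1}"
      have "?g t / (?g t - z) = 1 / (1 - z * cnj (?g t))"
        using nz[of t] unit[of t] by (simp add: field_simps)
      hence "?h (?g t) = poly p (?g t) * (?g t / (?g t - z))" by simp
      moreover have "vector_derivative (circlepath 0 1) (at t within {0..1}) = 2 * of_real pi * \<i> * ?g t"
        using t by (simp add: vector_derivative_circlepath01 cis_conv_exp mult_ac)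
      ultimately show "poly p (?g t) / (?g t - z) * vector_derivative (circlepath 0 1) (at t within {0..1})
          = 2 * of_real pi * \<i> * ?h (?g t)" by (simp add: mult_ac)
    qed
    from has_integral_mult_right[OF this, of "inverse (2 * of_real pi * \<i>)"]
    show "((\<lambda>t. ?h (?g t)) has_integral poly p z) {0..1}"
      by (simp add: field_simps)
  qed
  finally show ?thesis .
qed

end

theory Submission
  imports Defs "HOL-Real_Asymp.Real_Asymp"
begin

text \<open>Take first \<open>\<mu> = \<Sum> m\<^sub>i \<delta>\<close> at finitely many points \<open>l\<^sub>i\<close>, and let
  \<open>\<phi> z = - (1 / A) \<Sum> m\<^sub>i (1 - \<bar>z\<bar>\<^sup>2) / \<bar>1 - cnj l\<^sub>i z\<bar>\<^sup>2\<close>. This is a subharmonic function which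
  vanishes on the circle and is at least \<open>-1\<close> at the points \<open>l\<^sub>i\<close>. With \<open>\<Delta>\<close> a quarter of the Laplacian,
  \<open>\<Delta> (e\<^sup>\<phi> \<bar>f\<bar>\<^sup>2) \<ge> e\<^sup>\<phi> \<bar>f\<bar>\<^sup>2 \<Delta> \<phi>\<close>, and Green's formula with weight \<open>1 - \<bar>z\<bar>\<^sup>2\<close> bounds
  \<open>(1 / \<pi>) \<integral> e\<^sup>\<phi> \<bar>f\<bar>\<^sup>2 \<Delta> \<phi> (1 - \<bar>z\<bar>\<^sup>2) dA\<close> by the squared norm of \<open>f\<close>, where
  \<open>\<Delta> \<phi> = (1 / A) \<Sum> m\<^sub>i (1 - \<bar>l\<^sub>i\<bar>\<^sup>2) / \<bar>1 - cnj l\<^sub>i z\<bar>\<^sup>4\<close>. Since \<open>\<phi>\<close> is subharmonic, each summand is bounded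
  from below by its value at the point \<open>l\<^sub>i\<close>, where \<open>e\<^sup>\<phi> \<ge> 1 / e\<close>. To make this explicit, \<open>\<phi>\<close> is minorised
  by the real part of a holomorphic function that agrees with it at \<open>l\<^sub>i\<close>, and the reproducing
  kernel of the Bergman space with weight \<open>1 - \<bar>z\<bar>\<^sup>2\<close> applies; it contributes the factor \<open>2\<close>.
  A general measure is discretised on compact parts of its support, and polynomials are dense.\<close>

subsection \<open>Green's formula on circles\<close>

text \<open>The parameter runs over the unit interval, which normalises the mean; at radius
  \<open>1\<close> this matches integration against \<open>circle_measure\<close>, and at radius
  \<open>0\<close> the value is \<open>h 0\<close>.\<close>

definition circle_mean :: "real \<Rightarrow> (complex \<Rightarrow> 'a::banach) \<Rightarrow> 'a" where
  "circle_mean r h = integral {0..1} (\<lambda>t. h (of_real r * cis (2 * pi * t)))"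

lemma norm_of_real_cis: "0 \<le> r \<Longrightarrow> cmod (of_real r * cis t) = r"
  by (simp add: norm_mult)

lemma continuous_on_polar:
  assumes "continuous_on (cball 0 1) h"
  shows "continuous_on ({0..1} \<times> {0..1}) (\<lambda>(r, t). h (of_real r * cis (2 * pi * t)))"
  unfolding case_prod_unfold
  by (rule continuous_on_compose2[OF assms])
     (auto intro!: continuous_intros simp: norm_mult)

lemma continuous_on_polar1:
  assumes "continuous_on (cball 0 1) h" "r \<in> {0..1}"
  shows "continuous_on {0..1} (\<lambda>t. h (of_real r * cis (2 * pi * t)))"
  by (rule continuous_on_compose2[OF assms(1)])
     (use assms in \<open>auto intro!: continuous_intros simp: norm_mult\<close>)

lemma circle_mean_integrable:
  fixes h :: "complex \<Rightarrow> 'a::banach"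
  assumes "continuous_on (cball 0 1) h" "r \<in> {0..1}"
  shows "(\<lambda>t. h (of_real r * cis (2 * pi * t))) integrable_on {0..1}"
  by (intro integrable_continuous_real continuous_on_polar1 assms)

lemma continuous_on_circle_mean [continuous_intros]:
  fixes h :: "complex \<Rightarrow> 'a::banach"
  assumes "continuous_on (cball 0 1) h"
  shows "continuous_on {0..1} (\<lambda>r. circle_mean r h)"
  using integral_continuous_on_param[of "{0..1}" 0 1 "\<lambda>r t. h (of_real r * cis (2 * pi * t))"]
    continuous_on_polar[OF assms]
  by (simp add: circle_mean_def)

lemma circle_mean_cong:
  assumes "\<And>z. cmod z = r \<Longrightarrow> f z = g z" "0 \<le> r"
  shows "circle_mean r f = circle_mean r g"
  unfolding circle_mean_def
  by (rule integral_cong) (use assms norm_of_real_cis in auto)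

lemma circle_mean_mono:
  fixes f g :: "complex \<Rightarrow> real"
  assumes "continuous_on (cball 0 1) f" "continuous_on (cball 0 1) g" "r \<in> {0..1}"
    and "\<And>z. cmod z = r \<Longrightarrow> f z \<le> g z"
  shows "circle_mean r f \<le> circle_mean r g"
  unfolding circle_mean_def
  by (rule integral_le) (use assms norm_of_real_cis in \<open>auto intro: circle_mean_integrable\<close>)

text \<open>Wirtinger derivatives: \<open>a\<close> and \<open>b\<close> are the derivatives of \<open>f\<close> at \<open>z\<close> with respect to \<open>z\<close> and
  to its conjugate.\<close>

definition has_wirtinger :: "(complex \<Rightarrow> complex) \<Rightarrow> complex \<Rightarrow> complex \<Rightarrow> complex \<Rightarrow> bool" where
  "has_wirtinger f a b z \<longleftrightarrow> (f has_derivative (\<lambda>h. a * h + b * cnj h)) (at z)"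

lemma has_wirtinger_const: "has_wirtinger (\<lambda>z. c) 0 0 z"
  by (simp add: has_wirtinger_def)

lemma has_wirtinger_ident: "has_wirtinger (\<lambda>z. z) 1 0 z"
  by (simp add: has_wirtinger_def)

lemma has_wirtinger_eq:
  "has_wirtinger f a b z \<Longrightarrow> a = a' \<Longrightarrow> b = b' \<Longrightarrow> has_wirtinger f a' b' z"
  by simp

lemma has_wirtinger_holomorphic:
  "(f has_field_derivative a) (at z) \<Longrightarrow> has_wirtinger f a 0 z"
  unfolding has_wirtinger_def has_field_derivative_def by simp

lemma has_wirtinger_cnj:
  assumes "has_wirtinger f a b z"
  shows "has_wirtinger (\<lambda>z. cnj (f z)) (cnj b) (cnj a) z"
proof -
  have "((\<lambda>z. cnj (f z)) has_derivative (\<lambda>h. cnj (a * h + b * cnj h))) (at z)"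
    using assms unfolding has_wirtinger_def by (rule has_derivative_cnj)
  thus ?thesis unfolding has_wirtinger_def by (simp add: add.commute)
qed

lemma has_wirtinger_add:
  assumes "has_wirtinger f a b z" "has_wirtinger g c d z"
  shows "has_wirtinger (\<lambda>z. f z + g z) (a + c) (b + d) z"
  using has_derivative_add[OF assms[unfolded has_wirtinger_def]]
  unfolding has_wirtinger_def by (simp add: algebra_simps)

lemma has_wirtinger_mult:
  assumes "has_wirtinger f a b z" "has_wirtinger g c d z"
  shows "has_wirtinger (\<lambda>z. f z * g z) (a * g z + f z * c) (b * g z + f z * d) z"
  using has_derivative_mult[OF assms[unfolded has_wirtinger_def]]
  unfolding has_wirtinger_def by (simp add: algebra_simps)

lemma has_wirtinger_sum:
  assumes "\<And>i. i \<in> I \<Longrightarrow> has_wirtinger (f i) (a i) (b i) z"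
  shows "has_wirtinger (\<lambda>z. \<Sum>i\<in>I. f i z) (\<Sum>i\<in>I. a i) (\<Sum>i\<in>I. b i) z"
proof -
  have "((\<lambda>z. \<Sum>i\<in>I. f i z) has_derivative (\<lambda>h. \<Sum>i\<in>I. a i * h + b i * cnj h)) (at z)"
    by (rule has_derivative_sum) (use assms in \<open>auto simp: has_wirtinger_def\<close>)
  thus ?thesis unfolding has_wirtinger_def by (simp add: sum.distrib sum_distrib_right)
qed

lemma has_wirtinger_exp:
  assumes "has_wirtinger f a b z"
  shows "has_wirtinger (\<lambda>z. exp (f z)) (exp (f z) * a) (exp (f z) * b) z"
proof -
  have "(exp has_derivative (*) (exp (f z))) (at (f z))"
    using DERIV_exp[of "f z"] by (simp add: has_field_derivative_def)
  from has_derivative_compose[OF assms[unfolded has_wirtinger_def] this]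
  show ?thesis unfolding has_wirtinger_def by (simp add: algebra_simps)
qed

lemma has_wirtinger_continuous:
  assumes "\<And>z. z \<in> S \<Longrightarrow> has_wirtinger f (a z) (b z) z"
  shows "continuous_on S f"
  by (rule continuous_at_imp_continuous_on)
     (use assms in \<open>auto simp: has_wirtinger_def intro: has_derivative_continuous\<close>)

lemma has_wirtinger_vector_derivative:
  assumes "has_wirtinger f a b (c t)" "(c has_vector_derivative c') (at t within S)"
  shows "((\<lambda>t. f (c t)) has_vector_derivative a * c' + b * cnj c') (at t within S)"
proof -
  have "((\<lambda>t. f (c t)) has_derivative (\<lambda>h. a * (h *\<^sub>R c') + b * cnj (h *\<^sub>R c'))) (at t within S)"
    using has_derivative_compose[OF assms(2)[unfolded has_vector_derivative_def]
        assms(1)[unfolded has_wirtinger_def]] .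
  thus ?thesis by (simp add: has_vector_derivative_def algebra_simps)
qed

text \<open>Up to the factor \<open>2 * pi * \<i>\<close>, the function
  \<open>z * a z - cnj z * b z\<close> is the derivative of \<open>U\<close> along the circle, and
  its integral over the closed curve is zero.\<close>

lemma circle_mean_wirtinger_eq:
  assumes U: "\<And>z. z \<in> cball 0 1 \<Longrightarrow> has_wirtinger U (a z) (b z) z"
    and r: "r \<in> {0..1}"
    and cont: "continuous_on (cball 0 1) a" "continuous_on (cball 0 1) b"
  shows "circle_mean r (\<lambda>z. z * a z) = circle_mean r (\<lambda>z. cnj z * b z)"
proof -
  define c where "c t = of_real r * cis (2 * pi * t)" for t
  have c: "c t \<in> cball 0 1" for t using r by (simp add: c_def norm_mult)
  have dc: "(c has_vector_derivative (2 * pi * \<i> * c t)) (at t within {0..1})" for t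
    unfolding c_def by (auto intro!: derivative_eq_intros simp: has_vector_derivative_def scaleR_conv_of_real algebra_simps)
  have "((\<lambda>t. U (c t)) has_vector_derivative
          a (c t) * (2 * pi * \<i> * c t) + b (c t) * cnj (2 * pi * \<i> * c t)) (at t within {0..1})" for t
    by (rule has_wirtinger_vector_derivative[OF U[OF c] dc])
  from fundamental_theorem_of_calculus[OF zero_le_one this]
  have "((\<lambda>t. a (c t) * (2 * pi * \<i> * c t) + b (c t) * cnj (2 * pi * \<i> * c t)) has_integral 0) {0..1}"
    by (simp add: c_def cis_2pi)
  from has_integral_mult_right[OF this, of "1 / (2 * pi * \<i>)"]
  have "((\<lambda>t. c t * a (c t) - cnj (c t) * b (c t)) has_integral 0) {0..1}"
    by (elim has_integral_eq[rotated, THEN has_integral_eq_rhs]) (simp_all add: field_simps)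
  hence "integral {0..1} (\<lambda>t. c t * a (c t) - cnj (c t) * b (c t)) = 0" by blast
  moreover have "(\<lambda>t. c t * a (c t)) integrable_on {0..1}" "(\<lambda>t. cnj (c t) * b (c t)) integrable_on {0..1}"
    unfolding c_def using r
    by (intro circle_mean_integrable[of "\<lambda>z. z * a z"] circle_mean_integrable[of "\<lambda>z. cnj z * b z"] 
        continuous_intros cont; simp)+
  ultimately show ?thesis
    by (simp add: Henstock_Kurzweil_Integration.integral_diff circle_mean_def c_def)
qed

text \<open>Differentiation under the integral gives \<open>1 / r\<close> times the sum of the means
  of \<open>z * a z\<close> and \<open>cnj z * b z\<close>, which coincide by
  \<open>circle_mean_wirtinger_eq\<close>. The conjugate one is kept because for the function
  \<open>z * a z\<close> of \<open>green_circle_mean\<close> it is the one that contains the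
  Laplacian.\<close>

lemma circle_mean_has_vector_derivative:
  assumes U: "\<And>z. z \<in> cball 0 1 \<Longrightarrow> has_wirtinger U (a z) (b z) z"
    and r: "r \<in> {0<..<1}"
    and cont: "continuous_on (cball 0 1) a" "continuous_on (cball 0 1) b"
  shows "((\<lambda>r. circle_mean r U) has_vector_derivative
           2 / of_real r * circle_mean r (\<lambda>z. cnj z * b z)) (at r)"
proof -
  define c where "c t = cis (2 * pi * t)" for t
  define D where "D s t = a (of_real s * c t) * c t + b (of_real s * c t) * cnj (c t)" for s t
  have "((\<lambda>r. integral (cbox 0 1) (\<lambda>t. U (of_real r * c t))) has_vector_derivative
          integral (cbox 0 1) (D r)) (at r within {0..1})"
  proof (rule leibniz_rule_vector_derivative)
    fix s t :: real assume st: "s \<in> {0..1}"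
    have "((\<lambda>s. of_real s * c t) has_vector_derivative c t) (at s within {0..1})"
      by (auto intro!: derivative_eq_intros simp: has_vector_derivative_def scaleR_conv_of_real)
    moreover have "has_wirtinger U (a (of_real s * c t)) (b (of_real s * c t)) (of_real s * c t)"
      by (rule U) (use st in \<open>auto simp: c_def norm_mult\<close>)
    ultimately show "((\<lambda>s. U (of_real s * c t)) has_vector_derivative D s t) (at s within {0..1})"
      unfolding D_def by (rule has_wirtinger_vector_derivative[rotated])
  next
    fix s :: real assume "s \<in> {0..1}"
    thus "(\<lambda>t. U (of_real s * c t)) integrable_on cbox 0 1"
      using circle_mean_integrable[OF has_wirtinger_continuous[OF U]] by (simp add: c_def)
  next
    show "continuous_on ({0..1} \<times> cbox 0 1) (\<lambda>(s, t). D s t)"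
      using continuous_on_polar[OF cont(1)] continuous_on_polar[OF cont(2)]
      unfolding D_def c_def case_prod_unfold cbox_interval
      by (intro continuous_intros) auto
  qed (use r in auto)
  moreover have "at r within {0..1} = at r" using r by (simp add: at_within_Icc_at)
  moreover have "integral (cbox 0 1) (D r) = 1 / of_real r * 
    (circle_mean r (\<lambda>z. z * a z) + circle_mean r (\<lambda>z. cnj z * b z))"
  proof -
    have "integral (cbox 0 1) (D r) = integral {0..1} (\<lambda>t. 1 / of_real r * 
      ((of_real r * c t) * a (of_real r * c t) + cnj (of_real r * c t) * b (of_real r * c t)))"
      using r by (intro arg_cong2[where f = integral] ext refl) (simp_all add: D_def field_simps)
    also have "\<dots> = 1 / of_real r * (integral {0..1} (\<lambda>t. (of_real r * c t) * a (of_real r * c t))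
        + integral {0..1} (\<lambda>t. cnj (of_real r * c t) * b (of_real r * c t)))"
      unfolding integral_mult_right c_def using r
      by (subst Henstock_Kurzweil_Integration.integral_add)
         (auto intro!: continuous_intros cont 
           circle_mean_integrable[of "\<lambda>z. z * a z"] circle_mean_integrable[of "\<lambda>z. cnj z * b z", simplified])
    finally show ?thesis by (simp add: circle_mean_def c_def)
  qed
  moreover have "circle_mean r (\<lambda>z. z * a z) = circle_mean r (\<lambda>z. cnj z * b z)"
    by (rule circle_mean_wirtinger_eq[OF U]) (use r cont in auto)
  ultimately show ?thesis by (simp add: circle_mean_def c_def)
qed

text \<open>Here \<open>L\<close> is a quarter of the Laplacian of \<open>U\<close>: by the product
  rule, the conjugate derivative of \<open>z * a z\<close> is \<open>z\<close> times that of
  \<open>a\<close>. If M and N are the means of \<open>U\<close> and of \<open>z * a z\<close>, then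
  M' = 2 N / r and N' = 2 r times the mean of \<open>L\<close>. Hence the terms with N cancel in the
  derivative of (1 - r^2) N + r^2 M, and integrating it leaves only M at radius 1.\<close>

lemma green_circle_mean:
  assumes U: "\<And>z. z \<in> cball 0 1 \<Longrightarrow> has_wirtinger U (a z) (b z) z"
    and W: "\<And>z. z \<in> cball 0 1 \<Longrightarrow> has_wirtinger (\<lambda>z. z * a z) (d z) (z * L z) z"
    and cont: "continuous_on (cball 0 1) a" "continuous_on (cball 0 1) b"
      "continuous_on (cball 0 1) d" "continuous_on (cball 0 1) L"
  shows "((\<lambda>r. of_real (2 * r * (1 - r\<^sup>2)) * circle_mean r L + of_real (2 * r) * circle_mean r U)
            has_integral circle_mean 1 U) {0..1}"
proof -
  define N where "N r = circle_mean r (\<lambda>z. z * a z)" for r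
  define F where "F r = of_real (1 - r\<^sup>2) * N r + of_real (r\<^sup>2) * circle_mean r U" for r
  have "((\<lambda>r. of_real (2 * r * (1 - r\<^sup>2)) * circle_mean r L + of_real (2 * r) * circle_mean r U)
            has_integral F 1 - F 0) {0..1}"
  \<comment> \<open>The derivative formulas divide by \<open>r\<close>, so \<open>F\<close> is
    differentiated only in the interior and continuity takes care of the end point
    \<open>0\<close>.\<close>
  proof (rule fundamental_theorem_of_calculus_interior)
    show "continuous_on {0..1} F"
      unfolding F_def N_def
      by (intro continuous_intros cont has_wirtinger_continuous[OF U]) auto
    fix r :: real assume r: "r \<in> {0<..<1}"
    have M': "((\<lambda>r. circle_mean r U) has_vector_derivative 2 / of_real r * N r) (at r)"
      using circle_mean_has_vector_derivative[OF U r cont(1,2)]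
        circle_mean_wirtinger_eq[OF U _ cont(1,2), of r] r by (simp add: N_def)
    have "(N has_vector_derivative
            2 / of_real r * circle_mean r (\<lambda>z. cnj z * (z * L z))) (at r)"
      unfolding N_def
      by (rule circle_mean_has_vector_derivative[OF W r cont(3)]) (intro continuous_intros cont | assumption)+
    moreover have "circle_mean r (\<lambda>z. cnj z * (z * L z)) = circle_mean r (\<lambda>z. of_real (r\<^sup>2) * L z)"
    proof (rule circle_mean_cong)
      fix z :: complex assume "cmod z = r"
      hence "cnj z * z = of_real (r\<^sup>2)" by (metis complex_norm_square mult.commute)
      thus "cnj z * (z * L z) = of_real (r\<^sup>2) * L z" by (simp add: mult.assoc[symmetric])
    qed (use r in auto)
    moreover have "\<dots> = of_real (r\<^sup>2) * circle_mean r L"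
      by (simp add: circle_mean_def)
    ultimately have N': "(N has_vector_derivative 2 * of_real r * circle_mean r L) (at r)"
      using r by (simp add: power2_eq_square mult.assoc)
    have "((\<lambda>r. (1 - r\<^sup>2) *\<^sub>R N r + r\<^sup>2 *\<^sub>R circle_mean r U) has_vector_derivative
        (1 - r\<^sup>2) *\<^sub>R (2 * of_real r * circle_mean r L) + (- 2 * r) *\<^sub>R N r +
        (r\<^sup>2 *\<^sub>R (2 / of_real r * N r) + (2 * r) *\<^sub>R circle_mean r U)) (at r)"
      by (intro has_vector_derivative_add has_vector_derivative_scaleR M' N')
         (auto intro!: derivative_eq_intros)
    moreover have "(1 - r\<^sup>2) *\<^sub>R (2 * of_real r * circle_mean r L) + (- 2 * r) *\<^sub>R N r +
        (r\<^sup>2 *\<^sub>R (2 / of_real r * N r) + (2 * r) *\<^sub>R circle_mean r U) =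
        of_real (2 * r * (1 - r\<^sup>2)) * circle_mean r L + of_real (2 * r) * circle_mean r U"
      using r by (simp add: scaleR_conv_of_real field_simps power2_eq_square)
    ultimately show "(F has_vector_derivative
        of_real (2 * r * (1 - r\<^sup>2)) * circle_mean r L + of_real (2 * r) * circle_mean r U) (at r)"
      by (simp only: F_def[abs_def] scaleR_conv_of_real)
  qed auto
  moreover have "F 1 = circle_mean 1 U" "F 0 = 0"
    by (simp_all add: F_def N_def circle_mean_def)
  ultimately show ?thesis by simp
qed

subsection \<open>A weighted Bergman space\<close>

lemma one_minus_mult_cnj_nonzero:
  assumes "cmod l < 1" "cmod z \<le> 1"
  shows "1 - cnj l * z \<noteq> 0" "1 - l * cnj z \<noteq> 0"
proof -
  have "cmod l * cmod z < 1"
    using assms by (smt (verit) mult_left_le norm_ge_zero)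
  hence "cmod (cnj l * z) < 1" "cmod (l * cnj z) < 1" by (simp_all add: norm_mult)
  thus "1 - cnj l * z \<noteq> 0" "1 - l * cnj z \<noteq> 0" by auto
qed

text \<open>On the circle \<open>cmod z = r\<close> we have \<open>cnj z = r\<^sup>2 / z\<close>, which turns the mean into the Cauchy
  integral for the second derivative of \<open>z\<^sup>2 G z\<close> at \<open>r\<^sup>2 l\<close>.\<close>

lemma circle_mean_cauchy:
  assumes G: "G holomorphic_on ball 0 R" and R: "R > 1" and l: "cmod l < 1" and r: "0 < r" "r \<le> 1"
  shows "circle_mean r (\<lambda>z. G z * (2 / (1 - l * cnj z) ^ 3)) =
           (deriv ^^ 2) (\<lambda>z. z\<^sup>2 * G z) (of_real (r\<^sup>2) * l)"
proof -
  define w where "w = of_real (r\<^sup>2) * l"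
  define c where "c t = of_real r * cis (2 * pi * t)" for t
  have circ: "circlepath 0 r = c"
    by (simp add: c_def[abs_def] circlepath cis_conv_exp algebra_simps)
  have dc: "vector_derivative c (at t within {0..1}) = 2 * pi * \<i> * c t" if "t \<in> {0..1}" for t
    using that vector_derivative_circlepath01[of t 0 r]
    by (simp add: circ c_def cis_conv_exp mult_ac)
  let ?D = "(deriv ^^ 2) (\<lambda>z. z\<^sup>2 * G z) w"
  have sub: "cball 0 r \<subseteq> ball (0::complex) R" using r R by auto
  have w: "cmod w < r"
  proof -
    have "cmod w = r * (r * cmod l)" by (simp add: w_def norm_mult power2_eq_square)
    also have "r * cmod l < 1" using r l by (smt (verit) mult_left_le_one_le norm_ge_zero)
    finally show ?thesis using r by simp
  qed
  have "((\<lambda>u. (u\<^sup>2 * G u) / (u - w) ^ Suc 2) has_contour_integral (2 * pi * \<i>) / fact 2 * ?D) (circlepath 0 r)"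
  proof (rule Cauchy_has_contour_integral_higher_derivative_circlepath)
    have "(\<lambda>z. z\<^sup>2 * G z) holomorphic_on ball 0 R" by (intro holomorphic_intros G)
    thus "continuous_on (cball 0 r) (\<lambda>z. z\<^sup>2 * G z)" "(\<lambda>z. z\<^sup>2 * G z) holomorphic_on ball 0 r"
      using sub holomorphic_on_subset holomorphic_on_imp_continuous_on ball_subset_cball by blast+
  qed (use w in auto)
  hence "((\<lambda>t. (c t)\<^sup>2 * G (c t) / (c t - w) ^ 3 * (2 * pi * \<i> * c t)) has_integral
            pi * \<i> * ?D) {0..1}"
    unfolding has_contour_integral_def circ
    by (elim has_integral_eq[rotated, THEN has_integral_eq_rhs])
       (simp_all add: dc numeral_3_eq_3)
  from has_integral_mult_right[OF this, of "1 / (pi * \<i>)"]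
  have "((\<lambda>t. G (c t) * (2 / (1 - l * cnj (c t)) ^ 3)) has_integral ?D) {0..1}"
  proof (elim has_integral_eq[rotated, THEN has_integral_eq_rhs])
    fix t :: real
    have n: "cmod (c t) = r" using r by (simp add: c_def norm_mult)
    hence nz: "c t \<noteq> 0" "c t - w \<noteq> 0" using w r by auto
    have "c t * cnj (c t) = of_real (r\<^sup>2)" using n by (metis complex_norm_square)
    hence eq: "1 - l * cnj (c t) = (c t - w) / c t"
      using nz by (simp add: w_def field_simps)
    define x where "x = c t - w"
    have "x \<noteq> 0" using nz by (simp add: x_def)
    thus "1 / (of_real pi * \<i>) * ((c t)\<^sup>2 * G (c t) / (c t - w) ^ 3 * (of_real (2 * pi) * \<i> * c t)) =
        G (c t) * (2 / (1 - l * cnj (c t)) ^ 3)"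
      using nz(1) unfolding eq x_def[symmetric]
      by (simp add: field_simps power2_eq_square power3_eq_cube)
  qed auto
  thus ?thesis by (auto simp: circle_mean_def c_def w_def)
qed

lemma circle_mean_bounded_linear:
  assumes "bounded_linear L" "continuous_on (cball 0 1) h" "r \<in> {0..1}"
  shows "circle_mean r (\<lambda>z. L (h z)) = L (circle_mean r h)"
  unfolding circle_mean_def
  using integral_linear[OF circle_mean_integrable[OF assms(2,3)] assms(1)] by (simp add: o_def)

text \<open>The integral \<open>(1 / \<pi>) \<integral> h z (1 - \<bar>z\<bar>\<^sup>2) dA\<close> over the unit disc, in polar coordinates.\<close>

definition bergman_integral :: "(complex \<Rightarrow> 'a::banach) \<Rightarrow> 'a" where
  "bergman_integral h = integral {0..1} (\<lambda>r. (2 * r * (1 - r\<^sup>2)) *\<^sub>R circle_mean r h)"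

lemma bergman_integrable:
  fixes h :: "complex \<Rightarrow> 'a::banach"
  assumes "continuous_on (cball 0 1) h"
  shows "(\<lambda>r. (2 * r * (1 - r\<^sup>2)) *\<^sub>R circle_mean r h) integrable_on {0..1}"
  by (intro integrable_continuous_real continuous_intros assms)

lemma bergman_integral_bounded_linear:
  assumes L: "bounded_linear L" and h: "continuous_on (cball 0 1) h"
  shows "bergman_integral (\<lambda>z. L (h z)) = L (bergman_integral h)"
proof -
  have "bergman_integral (\<lambda>z. L (h z)) = integral {0..1} (\<lambda>r. L ((2 * r * (1 - r\<^sup>2)) *\<^sub>R circle_mean r h))"
    unfolding bergman_integral_def
    by (rule integral_cong)
       (simp add: circle_mean_bounded_linear[OF L h] linear_scale[OF bounded_linear.linear[OF L]])
  also have "\<dots> = L (bergman_integral h)"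
    using integral_linear[OF bergman_integrable[OF h] L] by (simp add: o_def bergman_integral_def)
  finally show ?thesis .
qed

lemma bergman_integral_add:
  fixes f g :: "complex \<Rightarrow> 'a::banach"
  assumes "continuous_on (cball 0 1) f" "continuous_on (cball 0 1) g"
  shows "bergman_integral (\<lambda>z. f z + g z) = bergman_integral f + bergman_integral g"
proof -
  have "bergman_integral (\<lambda>z. f z + g z) = integral {0..1} (\<lambda>r.
          (2 * r * (1 - r\<^sup>2)) *\<^sub>R circle_mean r f + (2 * r * (1 - r\<^sup>2)) *\<^sub>R circle_mean r g)"
    unfolding bergman_integral_def
    by (rule integral_cong)
       (simp add: circle_mean_def Henstock_Kurzweil_Integration.integral_add
         circle_mean_integrable assms scaleR_add_right)
  also have "\<dots> = bergman_integral f + bergman_integral g"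
    unfolding bergman_integral_def
    by (intro Henstock_Kurzweil_Integration.integral_add bergman_integrable assms)
  finally show ?thesis .
qed

lemma bergman_integral_sum:
  fixes f :: "'i \<Rightarrow> complex \<Rightarrow> 'a::banach"
  assumes "finite I" "\<And>i. i \<in> I \<Longrightarrow> continuous_on (cball 0 1) (f i)"
  shows "bergman_integral (\<lambda>z. \<Sum>i\<in>I. f i z) = (\<Sum>i\<in>I. bergman_integral (f i))"
  using assms
proof (induction I rule: finite_induct)
  case empty
  show ?case by (simp add: bergman_integral_def circle_mean_def)
next
  case (insert i I)
  thus ?case by (simp add: bergman_integral_add continuous_on_sum)
qed

lemma bergman_integral_mono:
  fixes f g :: "complex \<Rightarrow> real"
  assumes "continuous_on (cball 0 1) f" "continuous_on (cball 0 1) g"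
    and "\<And>z. z \<in> cball 0 1 \<Longrightarrow> f z \<le> g z"
  shows "bergman_integral f \<le> bergman_integral g"
  unfolding bergman_integral_def
  by (intro integral_le bergman_integrable assms scaleR_left_mono circle_mean_mono)
     (auto intro!: assms(3) simp: power_le_one)

text \<open>By \<open>circle_mean_cauchy\<close> the mean at radius r is Y''(r^2 l) with Y z = z^2 G
  z. Substituting x = r^2 leaves the integral of (1 - x) Y''(x l) over [0, 1]. Since Y and Y' vanish
  at 0, Taylor's formula with integral remainder says that l^2 times this integral is Y l = l^2 G
  l.\<close>

lemma bergman_reproducing:
  assumes G: "G holomorphic_on ball 0 R" and R: "R > 1" and l: "cmod l < 1"
  shows "bergman_integral (\<lambda>z. G z * (2 / (1 - l * cnj z) ^ 3)) = G l"
proof -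
  define G' where "G' = deriv G"
  define G'' where "G'' = deriv G'"
  let ?Y = "\<lambda>z. z\<^sup>2 * G z"
  have G': "G' holomorphic_on ball 0 R" unfolding G'_def by (intro holomorphic_deriv G) auto
  have dG: "(G has_field_derivative G' z) (at z)" if "cmod z < R" for z
    unfolding G'_def using G that by (intro holomorphic_derivI[of G "ball 0 R"]) auto
  have dG': "(G' has_field_derivative G'' z) (at z)" if "cmod z < R" for z
    unfolding G''_def using G' that by (intro holomorphic_derivI[of G' "ball 0 R"]) auto
  have Y: "(deriv ^^ 2) ?Y z = 2 * G z + 4 * z * G' z + z\<^sup>2 * G'' z" if z: "cmod z < R" for z
  proof -
    have d: "deriv ?Y w = 2 * w * G w + w\<^sup>2 * G' w" if "cmod w < R" for w
      by (rule DERIV_imp_deriv) (auto intro!: derivative_eq_intros dG that simp: algebra_simps)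
    have "(deriv ^^ 2) ?Y z = deriv (deriv ?Y) z" by (simp add: numeral_2_eq_2)
    also have "\<dots> = deriv (\<lambda>w. 2 * w * G w + w\<^sup>2 * G' w) z"
    proof (rule deriv_cong_ev)
      have "\<forall>\<^sub>F w in nhds z. w \<in> ball 0 R"
        using z by (intro eventually_nhds_in_open) auto
      thus "\<forall>\<^sub>F w in nhds z. deriv ?Y w = 2 * w * G w + w\<^sup>2 * G' w"
        by eventually_elim (simp add: d)
    qed auto
    also have "\<dots> = 2 * G z + 4 * z * G' z + z\<^sup>2 * G'' z"
      by (rule DERIV_imp_deriv) (auto intro!: derivative_eq_intros dG dG' that simp: algebra_simps)
    finally show ?thesis .
  qed
  \<comment> \<open>Integration by parts in \<open>\<integral> (1 - x) Y''(x l) dx\<close> with \<open>Y z = z\<^sup>2 G z\<close>; the negative powers of \<open>l\<close> cancel.\<close>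
  define F where "F x = (1 - x) * (2 * x * G (x * l) + l * x\<^sup>2 * G' (x * l)) + x\<^sup>2 * G (x * l)" for x
  have in_disc: "cmod (of_real (r\<^sup>2) * l) < R" if "r \<in> {0..1}" for r :: real
  proof -
    have "r\<^sup>2 * cmod l \<le> 1 * 1" using that l by (intro mult_mono power_le_one) auto
    thus ?thesis using R by (simp add: norm_mult norm_power)
  qed
  have dF: "(F has_field_derivative
      (1 - x) * (2 * G (x * l) + 4 * (x * l) * G' (x * l) + (x * l)\<^sup>2 * G'' (x * l))) (at x)"
    if "cmod (x * l) < R" for x
  proof -
    have g: "((\<lambda>x. G (x * l)) has_field_derivative G' (x * l) * l) (at x)"
      by (rule DERIV_chain2[where f = G and g = "\<lambda>x. x * l", OF dG[OF that]]) (auto intro!: derivative_eq_intros)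
    have g': "((\<lambda>x. G' (x * l)) has_field_derivative G'' (x * l) * l) (at x)"
      by (rule DERIV_chain2[where f = G' and g = "\<lambda>x. x * l", OF dG'[OF that]]) (auto intro!: derivative_eq_intros)
    show ?thesis unfolding F_def[abs_def]
      by (rule derivative_eq_intros g g' refl | simp)+ (simp add: algebra_simps power2_eq_square)
  qed
  have dF2: "((\<lambda>r. F (of_real (r\<^sup>2))) has_vector_derivative
        of_real (2 * r * (1 - r\<^sup>2)) * (deriv ^^ 2) ?Y (of_real (r\<^sup>2) * l)) (at r within S)"
    if "r \<in> {0..1}" for r S
  proof -
    have "((\<lambda>r. of_real (r\<^sup>2)) has_vector_derivative complex_of_real (2 * r)) (at r within S)"
      by (intro bounded_linear.has_vector_derivative[OF bounded_linear_of_real])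
         (auto intro!: derivative_eq_intros simp flip: has_real_derivative_iff_has_vector_derivative)
    from field_vector_diff_chain_within[OF this, of F,
        OF has_field_derivative_at_within[OF dF[OF in_disc[OF that]]]]
    show ?thesis unfolding Y[OF in_disc[OF that]] by (simp add: o_def algebra_simps)
  qed
  have "((\<lambda>r. of_real (2 * r * (1 - r\<^sup>2)) * circle_mean r (\<lambda>z. G z * (2 / (1 - l * cnj z) ^ 3)))
            has_integral F (of_real (1\<^sup>2)) - F (of_real (0\<^sup>2))) {0..1}"
  proof (rule fundamental_theorem_of_calculus_interior)
    show "continuous_on {0..1::real} (\<lambda>r. F (of_real (r\<^sup>2)))"
      using dF2 by (rule continuous_on_vector_derivative)
  qed (use dF2 circle_mean_cauchy[OF G R l] in auto)
  hence "((\<lambda>r. (2 * r * (1 - r\<^sup>2)) *\<^sub>R circle_mean r (\<lambda>z. G z * (2 / (1 - l * cnj z) ^ 3)))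
            has_integral G l) {0..1}"
    by (simp add: F_def scaleR_conv_of_real)
  thus ?thesis unfolding bergman_integral_def by blast
qed

text \<open>The radius \<open>2 / (1 + \<rho>)\<close> exceeds 1, while its product with
  \<open>\<rho>\<close> stays below 1. So the kernels are holomorphic on a common neighbourhood of
  the closed disc, as \<open>bergman_reproducing\<close> demands.\<close>

lemma one_minus_cnj_mult_nonzero_ball:
  assumes "cmod l \<le> \<rho>" "\<rho> < 1" "z \<in> ball 0 (2 / (1 + \<rho>))"
  shows "1 - cnj l * z \<noteq> 0"
proof -
  have \<rho>: "0 \<le> \<rho>" using assms(1) norm_ge_zero order_trans by blast
  have "cmod l * cmod z \<le> \<rho> * (2 / (1 + \<rho>))" using assms \<rho> by (intro mult_mono) auto
  also have "\<dots> < 1" using assms \<rho> by (simp add: divide_simps)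
  finally have "cmod (cnj l * z) < 1" by (simp add: norm_mult)
  thus ?thesis by auto
qed

text \<open>This is the Cauchy-Schwarz inequality for \<open>G\<close> and the reproducing kernel
  \<open>k\<close>, whose squared norm is \<open>k l = K\<close>.\<close>

lemma bergman_evaluation:
  assumes G: "G holomorphic_on ball 0 R" and R: "R > 1" and l: "cmod l < 1"
  shows "(1 - (cmod l)\<^sup>2) ^ 3 / 2 * (cmod (G l))\<^sup>2 \<le> bergman_integral (\<lambda>z. (cmod (G z))\<^sup>2)"
proof -
  define k where "k z = 2 / (1 - cnj l * z) ^ 3" for z
  define h where "h z = 2 / (1 - l * cnj z) ^ 3" for z
  define K where "K = 2 / (1 - (cmod l)\<^sup>2) ^ 3"
  define c where "c = G l / of_real K"
  have K: "K > 0" using l by (simp add: K_def power_less_one_iff abs_square_less_1)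
  have hk: "h z = cnj (k z)" for z by (simp add: h_def k_def)
  have kl: "k l = of_real K"
    unfolding k_def K_def using complex_norm_square[of l] by (simp add: mult.commute)
  have holk: "k holomorphic_on ball 0 (2 / (1 + cmod l))"
    unfolding k_def using one_minus_cnj_mult_nonzero_ball[OF order_refl l] by (intro holomorphic_intros) auto
  have R': "2 / (1 + cmod l) > 1" using l by (simp add: divide_simps add_pos_nonneg)
  have cont: "continuous_on (cball 0 1) G" "continuous_on (cball 0 1) k" "continuous_on (cball 0 1) h"
  proof -
    show "continuous_on (cball 0 1) G"
      using R by (intro holomorphic_on_imp_continuous_on holomorphic_on_subset[OF G]) auto
    show k: "continuous_on (cball 0 1) k"
      using R' by (intro holomorphic_on_imp_continuous_on holomorphic_on_subset[OF holk]) auto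
    show "continuous_on (cball 0 1) h" unfolding hk by (intro continuous_intros k)
  qed
  \<comment> \<open>The multiple \<open>c * k\<close> is the orthogonal projection of
    \<open>G\<close> onto \<open>k\<close>. The real part of \<open>f\<close> is |G|^2 - |G - c
    k|^2, hence at most |G|^2, and its integral follows from the reproducing property.\<close>
  define f where "f z = 2 * cnj c * (G z * h z) + - of_real ((cmod c)\<^sup>2) * (k z * h z)" for z
  have "bergman_integral f = 2 * cnj c * bergman_integral (\<lambda>z. G z * h z)
          + - of_real ((cmod c)\<^sup>2) * bergman_integral (\<lambda>z. k z * h z)"
    unfolding f_def
    by (subst bergman_integral_add)
       (intro continuous_intros cont arg_cong2[where f = "(+)"]
         bergman_integral_bounded_linear[OF bounded_linear_mult_right])+
  also have "\<dots> = 2 * cnj c * G l - of_real ((cmod c)\<^sup>2) * of_real K"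
    unfolding h_def bergman_reproducing[OF G R l] bergman_reproducing[OF holk R' l] kl by simp
  also have "\<dots> = of_real ((cmod (G l))\<^sup>2 / K)"
    using K complex_norm_square[of "G l"]
    by (simp add: c_def norm_divide power_divide field_simps power2_eq_square)
  finally have "(cmod (G l))\<^sup>2 / K = Re (bergman_integral f)" by simp
  also have "\<dots> = bergman_integral (\<lambda>z. Re (f z))"
    by (rule bergman_integral_bounded_linear[symmetric, OF bounded_linear_Re])
       (unfold f_def, intro continuous_intros cont)
  also have "\<dots> \<le> bergman_integral (\<lambda>z. (cmod (G z))\<^sup>2)"
  proof (rule bergman_integral_mono)
    fix z
    have "Re (f z) = 2 * Re (G z * cnj (c * k z)) - (cmod (c * k z))\<^sup>2"
      by (simp add: f_def hk complex_mult_cnj cmod_power2 norm_mult power_mult_distrib algebra_simps)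
    also have "\<dots> = (cmod (G z))\<^sup>2 - (cmod (G z - c * k z))\<^sup>2"
      by (simp only: cmod_power2) (simp add: power2_eq_square algebra_simps)
    finally show "Re (f z) \<le> (cmod (G z))\<^sup>2" by simp
  qed (auto simp: f_def intro!: continuous_intros cont)
  finally show ?thesis by (simp add: K_def mult.commute)
qed

section \<open>Green's inequality, and holomorphic majorants of the kernel terms\<close>

lemma green_bergman_le:
  fixes U L :: "complex \<Rightarrow> real"
  assumes U: "\<And>z. z \<in> cball 0 1 \<Longrightarrow> has_wirtinger (\<lambda>z. of_real (U z)) (a z) (b z) z"
    and W: "\<And>z. z \<in> cball 0 1 \<Longrightarrow> has_wirtinger (\<lambda>z. z * a z) (d z) (z * of_real (L z)) z"
    and cont: "continuous_on (cball 0 1) a" "continuous_on (cball 0 1) b"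
      "continuous_on (cball 0 1) d" "continuous_on (cball 0 1) L"
    and U0: "\<And>z. U z \<ge> 0"
  shows "bergman_integral L \<le> circle_mean 1 U"
proof -
  have "continuous_on (cball 0 1) (\<lambda>z. complex_of_real (U z))" using U by (rule has_wirtinger_continuous)
  from continuous_on_Re[OF this] have contU: "continuous_on (cball 0 1) U" by simp
  have "((\<lambda>r. of_real (2 * r * (1 - r\<^sup>2)) * circle_mean r (\<lambda>z. complex_of_real (L z)) + of_real (2 * r) * circle_mean r (\<lambda>z. complex_of_real (U z)))
            has_integral circle_mean 1 (\<lambda>z. complex_of_real (U z))) {0..1}"
    using U W by (rule green_circle_mean) (intro continuous_intros cont | assumption)+
  hence "((\<lambda>r. complex_of_real (2 * r * (1 - r\<^sup>2) * circle_mean r L + 2 * r * circle_mean r U))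
            has_integral of_real (circle_mean 1 U)) {0..1}"
    by (elim has_integral_eq[rotated, THEN has_integral_eq_rhs])
       (simp_all add: circle_mean_bounded_linear[OF bounded_linear_of_real] cont contU)
  from has_integral_linear[OF this bounded_linear_Re]
  have hi: "((\<lambda>r. 2 * r * (1 - r\<^sup>2) * circle_mean r L + 2 * r * circle_mean r U)
            has_integral circle_mean 1 U) {0..1}" by (simp add: o_def)
  show ?thesis unfolding bergman_integral_def
  proof (rule has_integral_le[OF integrable_integral[OF bergman_integrable] hi])
    fix r :: real assume r: "r \<in> {0..1}"
    \<comment> \<open>Nonnegativity of \<open>U\<close> allows its own term in Green's formula to be
      dropped.\<close>
    have "0 \<le> circle_mean r U" unfolding circle_mean_def
      by (intro Henstock_Kurzweil_Integration.integral_nonneg circle_mean_integrable contU r U0)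
    thus "(2 * r * (1 - r\<^sup>2)) *\<^sub>R circle_mean r L \<le> 2 * r * (1 - r\<^sup>2) * circle_mean r L + 2 * r * circle_mean r U"
      using r by simp
  qed (rule cont)
qed

text \<open>With \<open>c = (1 - \<bar>l\<bar>\<^sup>2) / \<bar>1 - cnj s l\<bar>\<^sup>2\<close> this is the function \<open>c (1 + cnj \<eta> w) / (1 - cnj \<eta> w)\<close>, where
  \<open>w\<close> and \<open>\<eta>\<close> are the images of \<open>z\<close> and \<open>s\<close> under the automorphism of the disc that exchanges \<open>l\<close>
  and \<open>0\<close>. Its real part is \<open>c (1 - \<bar>\<eta> w\<bar>\<^sup>2) / \<bar>1 - cnj \<eta> w\<bar>\<^sup>2\<close>, and replacing \<open>\<bar>\<eta> w\<bar>\<close> by \<open>\<bar>w\<bar>\<close> gives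
  \<open>(1 - \<bar>z\<bar>\<^sup>2) / \<bar>1 - cnj s z\<bar>\<^sup>2\<close>.\<close>

definition majorant :: "complex \<Rightarrow> complex \<Rightarrow> complex \<Rightarrow> complex" where
  "majorant l s z = ((1 - l * cnj s) * (1 - cnj l * z) + (cnj l - cnj s) * (l - z)) /
     (of_real ((cmod (1 - cnj s * l))\<^sup>2) * (1 - cnj s * z))"

lemma cmod_pseudo_hyperbolic:
  "(cmod (1 - cnj l * z))\<^sup>2 - (cmod (l - z))\<^sup>2 = (1 - (cmod l)\<^sup>2) * (1 - (cmod z)\<^sup>2)"
  by (simp only: cmod_power2) (simp add: power2_eq_square algebra_simps)

text \<open>At \<open>z = l\<close> the inequality of \<open>majorant_ge\<close> becomes an
  equality, so nothing is lost at the point of evaluation.\<close>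

lemma majorant_diag:
  assumes "cmod l < 1" "cmod s < 1"
  shows "majorant l s l = of_real ((1 - (cmod l)\<^sup>2) / (cmod (1 - cnj s * l))\<^sup>2)"
proof -
  have "1 - l * cnj s \<noteq> 0" using one_minus_mult_cnj_nonzero(1)[of s l] assms by (simp add: mult.commute)
  moreover have "1 - cnj l * l = of_real (1 - (cmod l)\<^sup>2)"
    using complex_norm_square[of l] by (simp add: mult.commute)
  ultimately show ?thesis by (simp add: majorant_def field_simps)
qed

text \<open>The majorant is (X + Y) / (e w), where X - Y = u w, so its real part times u e D is
  |X|^2 - |Y|^2. The only estimate is |s - l|^2 \<le> e, which says that the pseudo-hyperbolic
  distance of \<open>s\<close> and \<open>l\<close> is at most 1;
  \<open>cmod_pseudo_hyperbolic\<close> then evaluates the remaining difference.\<close>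

lemma majorant_ge:
  assumes l: "cmod l < 1" and s: "cmod s < 1" and z: "cmod z \<le> 1"
  shows "(1 - (cmod z)\<^sup>2) / (cmod (1 - cnj s * z))\<^sup>2 \<le> Re (majorant l s z)"
proof -
  define X Y where "X = (1 - l * cnj s) * (1 - cnj l * z)" and "Y = (cnj l - cnj s) * (l - z)"
  define e where "e = (cmod (1 - cnj s * l))\<^sup>2"
  define D where "D = (cmod (1 - cnj s * z))\<^sup>2"
  define u where "u = 1 - (cmod l)\<^sup>2"
  have e: "e > 0" using one_minus_mult_cnj_nonzero(1)[of s l] l s by (simp add: e_def)
  have D: "D > 0" using one_minus_mult_cnj_nonzero(1)[OF s z] by (simp add: D_def)
  have u: "u > 0" using l by (simp add: u_def abs_square_less_1)
  have u': "complex_of_real u = 1 - l * cnj l" using complex_norm_square[of l] by (simp add: u_def)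
  have XY: "X - Y = of_real u * (1 - cnj s * z)"
    by (simp add: X_def Y_def u' algebra_simps)
  define w where "w = 1 - cnj s * z"
  have w: "w \<noteq> 0" using one_minus_mult_cnj_nonzero(1)[OF s z] by (simp add: w_def)
  have "majorant l s z = (X + Y) / (of_real e * w)"
    by (simp add: majorant_def X_def Y_def e_def w_def)
  also have "\<dots> = (X + Y) * cnj w / of_real (e * D)"
    using w unfolding D_def w_def[symmetric] of_real_mult complex_norm_square by simp
  finally have "Re (majorant l s z) = Re ((X + Y) * cnj w) / (e * D)"
    by (simp add: Re_divide_of_real)
  moreover have "u * Re ((X + Y) * cnj w) = (cmod X)\<^sup>2 - (cmod Y)\<^sup>2"
  proof -
    have "u * Re ((X + Y) * cnj w) = Re ((X + Y) * cnj (X - Y))"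
      unfolding XY w_def[symmetric] by (simp add: algebra_simps)
    also have "\<dots> = (cmod X)\<^sup>2 - (cmod Y)\<^sup>2"
      by (simp only: cmod_power2) (simp add: power2_eq_square algebra_simps)
    finally show ?thesis .
  qed
  moreover have "u * ((1 - (cmod z)\<^sup>2) * e) \<le> (cmod X)\<^sup>2 - (cmod Y)\<^sup>2"
  proof -
    have "cmod (1 - l * cnj s) = cmod (1 - cnj s * l)" by (simp add: mult.commute)
    hence X: "(cmod X)\<^sup>2 = e * (cmod (1 - cnj l * z))\<^sup>2"
      by (simp add: X_def e_def norm_mult power_mult_distrib)
    have "(cmod (s - l))\<^sup>2 \<le> e"
    proof -
      have "0 \<le> (1 - (cmod s)\<^sup>2) * (1 - (cmod l)\<^sup>2)"
        using l s by (intro mult_nonneg_nonneg) (simp_all add: power_le_one)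
      thus ?thesis using cmod_pseudo_hyperbolic[of s l] by (simp only: e_def)
    qed
    moreover have "cmod (cnj l - cnj s) = cmod (s - l)"
      by (metis complex_cnj_diff complex_mod_cnj norm_minus_commute)
    ultimately have "(cmod Y)\<^sup>2 \<le> e * (cmod (l - z))\<^sup>2"
      by (simp add: Y_def norm_mult power_mult_distrib mult_right_mono)
    hence "e * ((cmod (1 - cnj l * z))\<^sup>2 - (cmod (l - z))\<^sup>2) \<le> (cmod X)\<^sup>2 - (cmod Y)\<^sup>2"
      unfolding X right_diff_distrib by simp
    thus ?thesis unfolding cmod_pseudo_hyperbolic u_def by (simp add: mult_ac)
  qed
  ultimately have "u * ((1 - (cmod z)\<^sup>2) * e) \<le> u * (Re (majorant l s z) * (e * D))"
    using e D by (simp del: times_complex.sel)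
  hence "(1 - (cmod z)\<^sup>2) * e \<le> Re (majorant l s z) * (e * D)"
    using u by (simp only: mult_le_cancel_left_pos)
  hence "(1 - (cmod z)\<^sup>2) \<le> Re (majorant l s z) * D"
    using e by (simp add: mult_ac mult_le_cancel_left_pos)
  thus ?thesis using D by (simp add: D_def[symmetric] divide_simps)
qed

subsection \<open>The embedding for finitely many point masses\<close>

lemma finite_embedding:
  fixes l :: "'i \<Rightarrow> complex" and m :: "'i \<Rightarrow> real" and p :: "complex poly"
  assumes fin: "finite I" and m: "\<And>i. i \<in> I \<Longrightarrow> m i \<ge> 0" and l: "\<And>i. i \<in> I \<Longrightarrow> cmod (l i) < 1"
    and A: "A > 0"
    and bound: "\<And>j. j \<in> I \<Longrightarrow>
       (\<Sum>i\<in>I. m i * ((1 - (cmod (l j))\<^sup>2) / (cmod (1 - cnj (l i) * l j))\<^sup>2)) \<le> A"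
  shows "(\<Sum>i\<in>I. m i * (cmod (poly p (l i)))\<^sup>2) \<le> 2 * exp 1 * A * circle_mean 1 (\<lambda>z. (cmod (poly p z))\<^sup>2)"
proof -

  \<comment> \<open>The weighted function, its derivatives and Green's formula\<close>
  define f f1 f2 where "f = poly p" and "f1 = poly (pderiv p)" and "f2 = poly (pderiv (pderiv p))"
  define q where "q i z = 1 / (1 - cnj (l i) * z)" for i z
  define M where "M i = complex_of_real (m i / A)" for i
  \<comment> \<open>\<open>\<phi>r\<close> is the weight and \<open>\<phi>\<close> its
    complex-valued form, written so that product rules apply. \<open>\<psi>\<close> and
    \<open>\<psi>1\<close> are its first two derivatives in \<open>z\<close>, and
    \<open>\<Lambda>r\<close> is the conjugate derivative of \<open>\<psi>\<close>, a quarter of its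
    Laplacian.\<close>
  define \<phi>r where "\<phi>r z = - (\<Sum>i\<in>I. m i / A * ((1 - (cmod z)\<^sup>2) / (cmod (1 - cnj (l i) * z))\<^sup>2))" for z
  define \<phi> where "\<phi> z = (\<Sum>i\<in>I. - M i * ((1 - z * cnj z) * (q i z * cnj (q i z))))" for z
  define \<psi> where "\<psi> z = (\<Sum>i\<in>I. - M i * ((cnj (l i) - cnj z) * ((q i z)\<^sup>2 * cnj (q i z))))" for z
  define \<psi>1 where "\<psi>1 z = (\<Sum>i\<in>I. - M i * ((cnj (l i) - cnj z) * (2 * cnj (l i) * (q i z) ^ 3 * cnj (q i z))))" for z
  define \<Lambda>r where "\<Lambda>r z = (\<Sum>i\<in>I. m i / A * ((1 - (cmod (l i))\<^sup>2) * (cmod (q i z)) ^ 4))" for z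
  define Ur where "Ur z = exp (\<phi>r z) * (cmod (f z))\<^sup>2" for z
  \<comment> \<open>Since \<open>f\<close> is holomorphic and the weight is real, the mixed
    derivative of \<open>Ur\<close> collects into a square plus a term with
    \<open>\<Lambda>r\<close>.\<close>
  define Lr where "Lr z = exp (\<phi>r z) * ((cmod (f1 z + \<psi> z * f z))\<^sup>2 + (cmod (f z))\<^sup>2 * \<Lambda>r z)" for z
  define a where "a z = exp (\<phi> z) * (cnj (f z) * (f1 z + \<psi> z * f z))" for z
  define b where "b z = exp (\<phi> z) * (f z * cnj (f1 z + \<psi> z * f z))" for z
  define d where "d z = a z + z * (exp (\<phi> z) * (cnj (f z) *
      (\<psi> z * (f1 z + \<psi> z * f z) + (f2 z + \<psi>1 z * f z + \<psi> z * f1 z))))" for z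
  have nz: "1 - cnj (l i) * z \<noteq> 0" "1 - l i * cnj z \<noteq> 0" if "i \<in> I" "z \<in> cball 0 1" for i z
    using one_minus_mult_cnj_nonzero[OF l[OF that(1)], of z] that(2) by auto
  have \<phi>: "\<phi> z = of_real (\<phi>r z)" for z
  proof -
    have "(1 - z * cnj z) * (q i z * cnj (q i z)) =
        of_real ((1 - (cmod z)\<^sup>2) / (cmod (1 - cnj (l i) * z))\<^sup>2)" for i
      unfolding complex_norm_square[symmetric] by (simp add: q_def norm_divide power_divide)
    thus ?thesis unfolding \<phi>_def \<phi>r_def M_def by (simp add: sum_negf)
  qed
  have expphi: "exp (\<phi> z) = of_real (exp (\<phi>r z))" for z by (simp add: \<phi> exp_of_real)
  have U: "complex_of_real (Ur z) = exp (\<phi> z) * (f z * cnj (f z))" for z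
    unfolding Ur_def expphi of_real_mult complex_norm_square by simp
  have wf: "has_wirtinger f (f1 z) 0 z" "has_wirtinger f1 (f2 z) 0 z" for z
    unfolding f_def f1_def f2_def by (intro has_wirtinger_holomorphic poly_DERIV)+
  have wcf: "has_wirtinger (\<lambda>z. cnj (f z)) 0 (cnj (f1 z)) z" for z
    using has_wirtinger_cnj[OF wf(1)] by simp
  have wcnj: "has_wirtinger cnj 0 1 z" for z
    using has_wirtinger_cnj[OF has_wirtinger_ident] by simp
  have wq: "has_wirtinger (q i) (cnj (l i) * (q i z)\<^sup>2) 0 z" if "i \<in> I" "z \<in> cball 0 1" for i z
    unfolding q_def using nz[OF that]
    by (intro has_wirtinger_holomorphic)
       (auto intro!: derivative_eq_intros simp: power2_eq_square)
  have wcq: "has_wirtinger (\<lambda>z. cnj (q i z)) 0 (l i * (cnj (q i z))\<^sup>2) z" if "i \<in> I" "z \<in> cball 0 1" for i z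
    using has_wirtinger_cnj[OF wq[OF that]] by simp
  \<comment> \<open>Expanding one \<open>q\<close> in this way brings the terms of a derivative to
    the same power of \<open>q\<close>, where they collapse into a single product.\<close>
  have q_eq: "q i z = (q i z)\<^sup>2 * (1 - cnj (l i) * z)"
     if "i \<in> I" "z \<in> cball 0 1" for i z
    using nz[OF that] by (simp add: q_def power2_eq_square)
  have w1: "has_wirtinger (\<lambda>z. 1 - z * cnj z) (- cnj z) (- z) z" for z
    using has_wirtinger_add[OF has_wirtinger_const[of 1] has_wirtinger_mult[OF has_wirtinger_const[of "-1"]
      has_wirtinger_mult[OF has_wirtinger_ident wcnj]], of z] by simp
  have w\<phi>: "has_wirtinger \<phi> (\<psi> z) (cnj (\<psi> z)) z" if z: "z \<in> cball 0 1" for z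
  proof -
    have "has_wirtinger (\<lambda>z. - M i * ((1 - z * cnj z) * (q i z * cnj (q i z))))
      (- M i * ((cnj (l i) - cnj z) * ((q i z)\<^sup>2 * cnj (q i z))))
      (cnj (- M i * ((cnj (l i) - cnj z) * ((q i z)\<^sup>2 * cnj (q i z))))) z" if i: "i \<in> I" for i
    proof -
      have *: "- cnj z * q i z + (1 - z * cnj z) * (cnj (l i) * (q i z)\<^sup>2) = (cnj (l i) - cnj z) * (q i z)\<^sup>2"
      proof -
        have "- cnj z * q i z + (1 - z * cnj z) * (cnj (l i) * (q i z)\<^sup>2) =
            - cnj z * ((q i z)\<^sup>2 * (1 - cnj (l i) * z)) + (1 - z * cnj z) * (cnj (l i) * (q i z)\<^sup>2)"
          using q_eq[OF i z] by simp
        also have "\<dots> = (cnj (l i) - cnj z) * (q i z)\<^sup>2" by (simp add: algebra_simps)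
        finally show ?thesis .
      qed
      show ?thesis
        apply (rule has_wirtinger_eq)
          apply (rule has_wirtinger_mult has_wirtinger_const w1 wq wcq i z)+
        subgoal using arg_cong[OF *, of "\<lambda>t. - M i * cnj (q i z) * t"] by (simp add: algebra_simps)
        subgoal using arg_cong[OF arg_cong[OF *, of cnj], of "\<lambda>t. - M i * q i z * t"]
          by (simp add: algebra_simps M_def)
        done
    qed
    thus ?thesis unfolding \<phi>_def \<psi>_def cnj_sum by (rule has_wirtinger_sum)
  qed
  have wq2: "has_wirtinger (\<lambda>z. (q i z)\<^sup>2) (2 * cnj (l i) * (q i z) ^ 3) 0 z" if "i \<in> I" "z \<in> cball 0 1" for i z
    using has_wirtinger_mult[OF wq[OF that] wq[OF that]]
    by (simp add: power2_eq_square power3_eq_cube mult_ac)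
  have wl: "has_wirtinger (\<lambda>z. cnj (l i) - cnj z) 0 (- 1) z" for i z
    using has_wirtinger_add[OF has_wirtinger_const[of "cnj (l i)"]
        has_wirtinger_mult[OF has_wirtinger_const[of "-1"] wcnj], of z] by simp
  have w\<psi>: "has_wirtinger \<psi> (\<psi>1 z) (of_real (\<Lambda>r z)) z" if z: "z \<in> cball 0 1" for z
  proof -
    have "has_wirtinger (\<lambda>z. - M i * ((cnj (l i) - cnj z) * ((q i z)\<^sup>2 * cnj (q i z))))
      (- M i * ((cnj (l i) - cnj z) * (2 * cnj (l i) * (q i z) ^ 3 * cnj (q i z))))
      (of_real (m i / A * ((1 - (cmod (l i))\<^sup>2) * (cmod (q i z)) ^ 4))) z" if i: "i \<in> I" for i
    proof -
      have "cnj (q i z) = (cnj (q i z))\<^sup>2 * (1 - l i * cnj z)"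
        using arg_cong[OF q_eq[OF i z], of cnj] by simp
      hence *: "cnj (q i z) - (cnj (l i) - cnj z) * (l i * (cnj (q i z))\<^sup>2) =
          (1 - l i * cnj (l i)) * (cnj (q i z))\<^sup>2"
        by (simp add: algebra_simps)
      have "complex_of_real ((cmod (q i z)) ^ 4) = (of_real ((cmod (q i z))\<^sup>2))\<^sup>2" by simp
      also have "\<dots> = (q i z)\<^sup>2 * (cnj (q i z))\<^sup>2"
        unfolding complex_norm_square by (simp add: power_mult_distrib)
      finally have **: "of_real (m i / A * ((1 - (cmod (l i))\<^sup>2) * (cmod (q i z)) ^ 4)) =
          M i * ((1 - l i * cnj (l i)) * ((q i z)\<^sup>2 * (cnj (q i z))\<^sup>2))"
        unfolding of_real_mult of_real_diff complex_norm_square M_def by simp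
      show ?thesis
        apply (rule has_wirtinger_eq)
          apply (rule has_wirtinger_mult has_wirtinger_const wl wq2 wcq i z)+
        subgoal by simp
        subgoal unfolding ** using arg_cong[OF *, of "\<lambda>t. M i * (q i z)\<^sup>2 * t"]
          by (simp add: algebra_simps)
        done
    qed
    thus ?thesis unfolding \<psi>_def \<psi>1_def \<Lambda>r_def of_real_sum by (rule has_wirtinger_sum)
  qed
  have wU: "has_wirtinger (\<lambda>z. of_real (Ur z)) (a z) (b z) z" if z: "z \<in> cball 0 1" for z
    unfolding U
    apply (rule has_wirtinger_eq)
      apply (rule has_wirtinger_mult has_wirtinger_exp wf wcf w\<phi> z)+
    by (simp_all add: a_def b_def algebra_simps)
  have wW: "has_wirtinger (\<lambda>z. z * a z) (d z) (z * of_real (Lr z)) z" if z: "z \<in> cball 0 1" for z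
  proof -
    have "complex_of_real (Lr z) = exp (\<phi> z) * ((f1 z + \<psi> z * f z) * cnj (f1 z + \<psi> z * f z) +
            (f z * cnj (f z)) * of_real (\<Lambda>r z))"
      unfolding Lr_def of_real_mult of_real_add complex_norm_square expphi ..
    thus ?thesis
      unfolding a_def[abs_def] d_def
      apply -
      apply (rule has_wirtinger_eq)
        apply (rule has_wirtinger_mult has_wirtinger_add has_wirtinger_ident has_wirtinger_exp wf wcf w\<phi> w\<psi> z)+
      by (simp_all add: algebra_simps)
  qed
  have contq: "continuous_on (cball 0 1) (q i)" if "i \<in> I" for i
    unfolding q_def using nz[OF that] by (intro continuous_intros) auto
  have contf: "continuous_on (cball 0 1) f" "continuous_on (cball 0 1) f1" "continuous_on (cball 0 1) f2"
    unfolding f_def f1_def f2_def by (intro continuous_intros)+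
  have cont\<phi>: "continuous_on (cball 0 1) \<phi>" "continuous_on (cball 0 1) \<psi>" "continuous_on (cball 0 1) \<psi>1"
      "continuous_on (cball 0 1) \<phi>r" "continuous_on (cball 0 1) \<Lambda>r"
    subgoal unfolding \<phi>_def by (intro continuous_intros contq)
    subgoal unfolding \<psi>_def by (intro continuous_intros contq)
    subgoal unfolding \<psi>1_def by (intro continuous_intros contq)
    subgoal unfolding \<phi>r_def using nz by (intro continuous_intros) auto
    subgoal unfolding \<Lambda>r_def by (intro continuous_intros contq)
    done
  have contL: "continuous_on (cball 0 1) Lr"
    unfolding Lr_def by (intro continuous_intros contf cont\<phi>)
  have "bergman_integral Lr \<le> circle_mean 1 Ur"
  proof (rule green_bergman_le[OF wU wW])
    show "continuous_on (cball 0 1) a" unfolding a_def by (intro continuous_intros contf cont\<phi>)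
    thus "continuous_on (cball 0 1) d" unfolding d_def by (intro continuous_intros contf cont\<phi>)
    show "continuous_on (cball 0 1) b" unfolding b_def by (intro continuous_intros contf cont\<phi>)
  qed (auto simp: Ur_def contL)
  also have "circle_mean 1 Ur = circle_mean 1 (\<lambda>z. (cmod (f z))\<^sup>2)"
    by (rule circle_mean_cong) (auto simp: Ur_def \<phi>r_def)
  finally have main: "bergman_integral Lr \<le> circle_mean 1 (\<lambda>z. (cmod (f z))\<^sup>2)" .

  \<comment> \<open>Lower bounds by evaluation at the point masses\<close>
  define \<rho> where "\<rho> = Max (insert 0 ((\<lambda>i. cmod (l i)) ` I))"
  \<comment> \<open>The inserted \<open>0\<close> keeps the maximum defined for empty
    \<open>I\<close> and gives \<open>\<rho> \<ge> 0\<close>.\<close>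
  have \<rho>: "\<rho> < 1" "\<And>i. i \<in> I \<Longrightarrow> cmod (l i) \<le> \<rho>" "\<rho> \<ge> 0"
    unfolding \<rho>_def using fin l by auto
  define R where "R = 2 / (1 + \<rho>)"
  have R: "R > 1" using \<rho> by (simp add: R_def)
  have nzR: "1 - cnj (l i) * z \<noteq> 0" if "i \<in> I" "z \<in> ball 0 R" for i z
    using one_minus_cnj_mult_nonzero_ball[OF \<rho>(2)[OF that(1)] \<rho>(1)] that(2) by (simp add: R_def)
  \<comment> \<open>A holomorphic function whose squared modulus lies below the integrand of the
    \<open>i\<close>-th summand. The exponent is halved because the modulus gets squared.\<close>
  define G where "G i z = exp (- (\<Sum>j\<in>I. M j * majorant (l i) (l j) z) / 2) * (f z * (q i z)\<^sup>2)" for i z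
  have G: "G i holomorphic_on ball 0 R" if i: "i \<in> I" for i
  proof -
    have "1 - cnj (l j) * l i \<noteq> 0" if "j \<in> I" for j
      using nz(1)[OF that, of "l i"] l[OF i] by simp
    thus ?thesis unfolding G_def majorant_def q_def f_def using nzR i
      by (intro holomorphic_intros) auto
  qed
  have normG: "(cmod (G i z))\<^sup>2 = exp (- (\<Sum>j\<in>I. m j / A * Re (majorant (l i) (l j) z))) *
      ((cmod (f z))\<^sup>2 * (cmod (q i z)) ^ 4)" for i z
  proof -
    have "exp x * exp x = exp (x + x)" for x :: real by (rule exp_add[symmetric])
    thus ?thesis
      by (simp add: G_def norm_mult power_mult_distrib norm_power M_def power4_eq_xxxx
         Re_sum power2_eq_square del: of_real_divide)
  qed
  have G_le: "(cmod (G i z))\<^sup>2 \<le> exp (\<phi>r z) * ((cmod (f z))\<^sup>2 * (cmod (q i z)) ^ 4)"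
    if "i \<in> I" "z \<in> cball 0 1" for i z
  proof -
    have "- (\<Sum>j\<in>I. m j / A * Re (majorant (l i) (l j) z)) \<le> \<phi>r z"
      unfolding \<phi>r_def using that m l A
      by (intro le_imp_neg_le sum_mono mult_left_mono majorant_ge) auto
    thus ?thesis unfolding normG by (intro mult_right_mono) auto
  qed
  \<comment> \<open>By \<open>majorant_diag\<close> the exponent at \<open>l i\<close> is minus the
    sum in \<open>bound\<close> divided by \<open>A\<close>, hence at least \<open>-1\<close>. The
    fourth power cancels that of \<open>q i\<close> at \<open>l i\<close>.\<close>
  have G_eq: "exp (-1) * (cmod (f (l i)))\<^sup>2 \<le> (1 - (cmod (l i))\<^sup>2) ^ 4 * (cmod (G i (l i)))\<^sup>2"
    if i: "i \<in> I" for i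
  proof -
    have pos: "1 - (cmod (l i))\<^sup>2 > 0" using l[OF i] by (simp add: abs_square_less_1)
    have "(\<Sum>j\<in>I. m j / A * Re (majorant (l i) (l j) (l i))) =
        (\<Sum>j\<in>I. m j * ((1 - (cmod (l i))\<^sup>2) / (cmod (1 - cnj (l j) * l i))\<^sup>2)) / A"
      unfolding sum_divide_distrib by (intro sum.cong refl) (simp add: majorant_diag l i)
    also have "\<dots> \<le> 1" using bound[OF i] A by simp
    finally have "exp (-1) \<le> exp (- (\<Sum>j\<in>I. m j / A * Re (majorant (l i) (l j) (l i))))" by simp
    moreover have "(1 - (cmod (l i))\<^sup>2) ^ 4 * (cmod (q i (l i))) ^ 4 = 1"
    proof -
      have "cmod (1 - cnj (l i) * l i) = 1 - (cmod (l i))\<^sup>2"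
        using pos complex_norm_square[of "l i"]
        by (metis abs_of_pos mult.commute norm_of_real of_real_1 of_real_diff)
      thus ?thesis using pos by (simp add: q_def norm_divide power_divide)
    qed
    ultimately have "exp (-1) * (cmod (f (l i)))\<^sup>2 \<le> exp (- (\<Sum>j\<in>I. m j / A * Re (majorant (l i) (l j) (l i)))) *
      (cmod (f (l i)))\<^sup>2 * ((1 - (cmod (l i))\<^sup>2) ^ 4 * (cmod (q i (l i))) ^ 4)"
      by (simp add: mult_right_mono)
    thus ?thesis unfolding normG by (simp add: mult_ac)
  qed
  have summand: "m i / A * (exp (-1) / 2 * (cmod (f (l i)))\<^sup>2) \<le> bergman_integral (\<lambda>z. m i / A * ((1 - (cmod (l i))\<^sup>2) * (exp (\<phi>r z) * ((cmod (f z))\<^sup>2 * (cmod (q i z)) ^ 4))))"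
    if i: "i \<in> I" for i
  proof -
    have pos: "1 - (cmod (l i))\<^sup>2 > 0" using l[OF i] by (simp add: abs_square_less_1)
    have cont: "continuous_on (cball 0 1) (\<lambda>z. exp (\<phi>r z) * ((cmod (f z))\<^sup>2 * (cmod (q i z)) ^ 4))"
      by (intro continuous_intros contf cont\<phi> contq i)
    \<comment> \<open>Of the four factors 1 - |l_i|^2, one comes from \<open>\<Lambda>r\<close> and
      three come from \<open>bergman_evaluation\<close>, together with the denominator 2.\<close>
    have "exp (-1) / 2 * (cmod (f (l i)))\<^sup>2 \<le> 
       (1 - (cmod (l i))\<^sup>2) * ((1 - (cmod (l i))\<^sup>2) ^ 3 / 2 * (cmod (G i (l i)))\<^sup>2)"
      using G_eq[OF i] by (simp add: power4_eq_xxxx power3_eq_cube mult_ac)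
    also have "\<dots> \<le> (1 - (cmod (l i))\<^sup>2) * bergman_integral (\<lambda>z. (cmod (G i z))\<^sup>2)"
      using pos bergman_evaluation[OF G[OF i] R l[OF i]] by (intro mult_left_mono) auto
    also have "bergman_integral (\<lambda>z. (cmod (G i z))\<^sup>2) \<le> 
        bergman_integral (\<lambda>z. exp (\<phi>r z) * ((cmod (f z))\<^sup>2 * (cmod (q i z)) ^ 4))"
    proof (rule bergman_integral_mono[OF _ cont G_le[OF i]])
      have "continuous_on (cball 0 1) (G i)"
        using R by (intro holomorphic_on_imp_continuous_on holomorphic_on_subset[OF G[OF i]]) auto
      thus "continuous_on (cball 0 1) (\<lambda>z. (cmod (G i z))\<^sup>2)" by (intro continuous_intros)
    qed
    finally have "m i / A * (exp (-1) / 2 * (cmod (f (l i)))\<^sup>2) \<le> m i / A * ((1 - (cmod (l i))\<^sup>2) *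
        bergman_integral (\<lambda>z. exp (\<phi>r z) * ((cmod (f z))\<^sup>2 * (cmod (q i z)) ^ 4)))"
      using m[OF i] A pos by (intro mult_left_mono) auto
    also have "\<dots> = bergman_integral (\<lambda>z. m i / A * ((1 - (cmod (l i))\<^sup>2) * (exp (\<phi>r z) * ((cmod (f z))\<^sup>2 * (cmod (q i z)) ^ 4))))"
      using bergman_integral_bounded_linear[OF bounded_linear_mult_right cont, of "m i / A * (1 - (cmod (l i))\<^sup>2)"]
      by (simp only: mult.assoc)
    finally show ?thesis .
  qed
  have "(\<Sum>i\<in>I. m i / A * (exp (-1) / 2 * (cmod (f (l i)))\<^sup>2)) \<le>
     (\<Sum>i\<in>I. bergman_integral (\<lambda>z. m i / A * ((1 - (cmod (l i))\<^sup>2) * (exp (\<phi>r z) * ((cmod (f z))\<^sup>2 * (cmod (q i z)) ^ 4)))))"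
    by (intro sum_mono summand)
  also have "\<dots> = bergman_integral (\<lambda>z. \<Sum>i\<in>I. m i / A * ((1 - (cmod (l i))\<^sup>2) * (exp (\<phi>r z) * ((cmod (f z))\<^sup>2 * (cmod (q i z)) ^ 4))))"
    by (rule bergman_integral_sum[OF fin, symmetric]) (intro continuous_intros contf cont\<phi> contq)
  also have "\<dots> \<le> bergman_integral Lr"
  proof (rule bergman_integral_mono)
    fix z
    have "(\<Sum>i\<in>I. m i / A * ((1 - (cmod (l i))\<^sup>2) * (exp (\<phi>r z) * ((cmod (f z))\<^sup>2 * (cmod (q i z)) ^ 4)))) =
       exp (\<phi>r z) * ((cmod (f z))\<^sup>2 * \<Lambda>r z)"
      unfolding \<Lambda>r_def sum_distrib_left by (intro sum.cong refl) (simp only: mult_ac)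
    \<comment> \<open>The squared modulus of \<open>f1 z + \<psi> z * f z\<close> is
      discarded.\<close>
    also have "\<dots> \<le> Lr z" unfolding Lr_def by (intro mult_left_mono) auto
    finally show "(\<Sum>i\<in>I. m i / A * ((1 - (cmod (l i))\<^sup>2) * (exp (\<phi>r z) * ((cmod (f z))\<^sup>2 * (cmod (q i z)) ^ 4)))) \<le> Lr z" .
  qed (intro continuous_intros contf cont\<phi> contq contL, assumption?)+
  also note main
  finally have "(\<Sum>i\<in>I. m i * (cmod (f (l i)))\<^sup>2) * (exp (-1) / (2 * A)) \<le> circle_mean 1 (\<lambda>z. (cmod (f z))\<^sup>2)"
    by (simp add: sum_distrib_left sum_divide_distrib mult_ac)
  thus ?thesis using A by (simp add: f_def exp_minus field_simps)
qed

subsection \<open>Discretisation\<close>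

lemma closed_support_complement_open:
  obtains W where "open W" "space M - closed_support M = W \<inter> space M"
proof
  let ?W = "\<Union>{U. open U \<and> emeasure M (U \<inter> space M) = 0}"
  show "open ?W" by auto
  show "space M - closed_support M = ?W \<inter> space M"
    by (auto simp: closed_support_def zero_less_iff_neq_zero)
qed

text \<open>The complement is covered by relatively open null sets, and Lindelof's theorem selects
  countably many of them.\<close>

lemma null_sets_closed_support_complement:
  fixes M :: "'a::second_countable_topology measure"
  assumes sets: "\<And>U. open U \<Longrightarrow> U \<inter> space M \<in> sets M"
  shows "space M - closed_support M \<in> null_sets M"
proof -
  define F where "F = {U. open U \<and> emeasure M (U \<inter> space M) = 0}"
  obtain F' where F': "F' \<subseteq> F" "countable F'" "\<Union>F' = \<Union>F"
    using Lindelof[of F] by (auto simp: F_def)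
  have "(\<Union>U\<in>F'. U \<inter> space M) \<in> null_sets M"
    using F' sets by (intro null_sets_UN') (auto simp: F_def null_sets_def)
  moreover have "(\<Union>U\<in>F'. U \<inter> space M) = space M - closed_support M"
  proof -
    have "(\<Union>U\<in>F'. U \<inter> space M) = \<Union>F \<inter> space M" using F'(3) by auto
    also have "\<dots> = space M - closed_support M"
      by (auto simp: F_def closed_support_def zero_less_iff_neq_zero)
    finally show ?thesis .
  qed
  ultimately show ?thesis by simp
qed

lemma sum_indicator_partition:
  fixes c :: "'i \<Rightarrow> ennreal"
  assumes "finite I" "disjoint_family_on E I" "i \<in> I" "x \<in> E i"
  shows "(\<Sum>j\<in>I. c j * indicator (E j) x) = c i"
proof -
  have "(\<Sum>j\<in>I. c j * indicator (E j) x) = (\<Sum>j\<in>I. if j = i then c j else 0)"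
    using assms by (intro sum.cong) (auto simp: indicator_def disjoint_family_on_def)
  thus ?thesis using assms by simp
qed

lemma nn_integral_step:
  fixes c :: "'i \<Rightarrow> ennreal"
  assumes "finite I" "\<And>i. i \<in> I \<Longrightarrow> E i \<in> sets M"
  shows "(\<integral>\<^sup>+x. (\<Sum>i\<in>I. c i * indicator (E i) x) \<partial>M) = (\<Sum>i\<in>I. c i * emeasure M (E i))"
  using assms by (subst nn_integral_sum) (auto simp: nn_integral_cmult_indicator)

text \<open>A finite cover by balls centred in \<open>K\<close> is made disjoint. A centre
  \<open>x i\<close> may fall outside its own piece \<open>E i\<close>, but it lies in
  \<open>K\<close>, where the kernel bound is available.\<close>

lemma compact_partition:
  fixes K :: "'a::metric_space set"
  assumes K: "compact K" and d: "d > 0"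
  obtains n :: nat and x E where "\<And>i. i < n \<Longrightarrow> x i \<in> K" "\<And>i. E i \<in> sets borel"
    "disjoint_family_on E {..<n}" "(\<Union>i<n. E i) = K" "\<And>i y. i < n \<Longrightarrow> y \<in> E i \<Longrightarrow> dist (x i) y < d"
proof -
  obtain C where C: "C \<subseteq> K" "finite C" "K \<subseteq> (\<Union>c\<in>C. ball c d)"
    by (rule compactE_image[OF K, of K "\<lambda>c. ball c d"]) (use d in auto)
  obtain n and x :: "nat \<Rightarrow> 'a" where x: "C = x ` {i. i < n}"
    using finite_imp_nat_seg_image_inj_on[OF C(2)] by blast
  define E where "E = disjointed (\<lambda>i. ball (x i) d \<inter> K)"
  have sub: "E i \<subseteq> ball (x i) d \<inter> K" for i unfolding E_def by (rule disjointed_subset)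
  show ?thesis
  proof
    show "x i \<in> K" if "i < n" for i using that C x by auto
    have "range E \<subseteq> sets borel"
      unfolding E_def using K by (intro sets.range_disjointed_sets) (auto intro: borel_compact)
    thus "E i \<in> sets borel" for i by auto
    show "disjoint_family_on E {..<n}"
      using disjoint_family_disjointed[of "\<lambda>i. ball (x i) d \<inter> K"]
      by (auto simp: E_def disjoint_family_on_def)
    have "(\<Union>i<n. E i) = (\<Union>i<n. ball (x i) d \<inter> K)"
      unfolding E_def by (simp only: atLeast0LessThan[symmetric] finite_UN_disjointed_eq)
    thus "(\<Union>i<n. E i) = K" using C x by auto
    show "dist (x i) y < d" if "i < n" "y \<in> E i" for i y using sub[of i] that by auto
  qed
qed

lemma norm_normalized_kernel:
  assumes "cmod l < 1"
  shows "(cmod (normalized_kernel l z))\<^sup>2 = (1 - (cmod l)\<^sup>2) / (cmod (1 - cnj z * l))\<^sup>2"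
proof -
  have "cmod (1 - z * cnj l) = cmod (1 - cnj z * l)"
    using complex_mod_cnj[of "1 - z * cnj l"] by simp
  thus ?thesis using assms
    by (simp add: normalized_kernel_def norm_divide power_divide abs_square_le_1)
qed

text \<open>The mass of each piece of a fine partition of \<open>K\<close> is moved to a point of
  \<open>K\<close>. Uniform continuity on \<open>K\<close> keeps the kernel sums and the values of
  |p|^2 within \<eta>, so \<open>finite_embedding\<close> applies with a slightly larger
  constant.\<close>

lemma poly_embedding_compact:
  fixes \<mu> :: "complex measure"
  assumes sets: "sets \<mu> = sets (restrict_space borel (ball 0 1))"
    and fin: "finite_measure \<mu>"
    and K: "compact K" "K \<subseteq> ball 0 1"
    and A: "A \<ge> 0"
    and bound: "\<And>l. l \<in> K \<Longrightarrow> (\<integral>\<^sup>+z. ennreal ((cmod (normalized_kernel l z))\<^sup>2) \<partial>\<mu>) \<le> ennreal A"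
  shows "(\<integral>\<^sup>+z\<in>K. ennreal ((cmod (poly p z))\<^sup>2) \<partial>\<mu>)
           \<le> ennreal (2 * exp 1 * A * circle_mean 1 (\<lambda>z. (cmod (poly p z))\<^sup>2))"
proof (rule ennreal_le_epsilon)
  fix e :: real assume e: "e > 0"
  interpret finite_measure \<mu> by fact
  have space: "space \<mu> = ball 0 1"
    using sets_eq_imp_space_eq[OF sets] by (simp add: space_restrict_space)
  define B where "B = measure \<mu> (space \<mu>)"
  have B: "B \<ge> 0" by (simp add: B_def)
  define M where "M = circle_mean 1 (\<lambda>z. (cmod (poly p z))\<^sup>2)"
  \<comment> \<open>Chosen to keep the total error, namely the enlarged constant times
    \<open>M\<close> plus \<open>\<eta> * B\<close>, below \<open>e\<close>. The absolute value and
    the last summand \<open>1\<close> make the denominator positive.\<close>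
  define \<eta> where "\<eta> = e / (2 * exp 1 * (B + 1) * \<bar>M\<bar> + B + 1)"
  have \<eta>: "\<eta> > 0" unfolding \<eta>_def using e B by (intro divide_pos_pos add_nonneg_pos) auto
  have \<eta>_le: "2 * exp 1 * (\<eta> * B + \<eta>) * M + \<eta> * B \<le> e"
  proof -
    have "2 * exp 1 * (\<eta> * B + \<eta>) * M + \<eta> * B = \<eta> * (2 * exp 1 * (B + 1) * M + B)"
      by (simp add: algebra_simps)
    also have "\<dots> \<le> \<eta> * (2 * exp 1 * (B + 1) * \<bar>M\<bar> + B + 1)"
    proof (intro mult_left_mono)
      have "2 * exp 1 * (B + 1) * M \<le> 2 * exp 1 * (B + 1) * \<bar>M\<bar>"
        using B by (intro mult_left_mono) auto
      thus "2 * exp 1 * (B + 1) * M + B \<le> 2 * exp 1 * (B + 1) * \<bar>M\<bar> + B + 1" by linarith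
    qed (use \<eta> in auto)
    also have "\<dots> = e" unfolding \<eta>_def using e B
      by (simp add: add_nonneg_pos order_less_imp_not_eq2 add_nonneg_eq_0_iff)
    finally show ?thesis .
  qed
  define \<kappa> where "\<kappa> s z = (1 - (cmod z)\<^sup>2) / (cmod (1 - cnj s * z))\<^sup>2" for s z
  have nz: "1 - cnj s * z \<noteq> 0" if "s \<in> K" "z \<in> K" for s z
  proof -
    have "s \<in> ball 0 1" "z \<in> ball 0 1" using K(2) that by blast+
    thus ?thesis by (intro one_minus_mult_cnj_nonzero) auto
  qed
  have "uniformly_continuous_on (K \<times> K) (\<lambda>(s, z). \<kappa> s z)"
    unfolding \<kappa>_def case_prod_unfold using nz
    by (intro compact_uniformly_continuous compact_Times K continuous_intros) auto
  then obtain d1 where d1: "d1 > 0" and "\<And>s z s' z'. s \<in> K \<Longrightarrow> z \<in> K \<Longrightarrow> s' \<in> K \<Longrightarrow> z' \<in> K \<Longrightarrow>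
      dist (s', z') (s, z) < d1 \<Longrightarrow> dist (\<kappa> s' z') (\<kappa> s z) < \<eta>"
    unfolding uniformly_continuous_on_def using \<eta> by (auto 4 4)
  hence d1': "\<kappa> s' z \<le> \<kappa> s z + \<eta>" if "s \<in> K" "s' \<in> K" "z \<in> K" "dist s' s < d1" for s s' z
    using that by (fastforce simp: dist_Pair_Pair dist_real_def)
  have "uniformly_continuous_on K (\<lambda>z. (cmod (poly p z))\<^sup>2)"
    by (intro compact_uniformly_continuous K continuous_intros)
  then obtain d2 where d2: "d2 > 0" and "\<And>s s'. s \<in> K \<Longrightarrow> s' \<in> K \<Longrightarrow> dist s' s < d2 \<Longrightarrow>
      dist ((cmod (poly p s'))\<^sup>2) ((cmod (poly p s))\<^sup>2) < \<eta>"
    unfolding uniformly_continuous_on_def using \<eta> by metis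
  hence d2': "(cmod (poly p s))\<^sup>2 \<le> (cmod (poly p s'))\<^sup>2 + \<eta>" if "s \<in> K" "s' \<in> K" "dist s' s < d2" for s s'
    using that by (fastforce simp: dist_real_def)
  obtain n :: nat and x E where x: "\<And>i. i < n \<Longrightarrow> x i \<in> K" and Eb: "\<And>i. E i \<in> sets borel"
    and disj: "disjoint_family_on E {..<n}" and UN: "(\<Union>i<n. E i) = K" 
    and dist: "\<And>i y. i < n \<Longrightarrow> y \<in> E i \<Longrightarrow> dist (x i) y < min d1 d2"
    using compact_partition[OF K(1), of "min d1 d2"] d1 d2 by (metis min_less_iff_conj)
  have E: "E i \<in> sets \<mu>" if "i < n" for i
    unfolding sets using Eb[of i] UN K(2) that
    by (auto simp: sets_restrict_space_iff)
  have EK: "y \<in> K" if "i < n" "y \<in> E i" for i y using UN that by auto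
  define m where "m i = measure \<mu> (E i)" for i
  have em: "emeasure \<mu> (E i) = ennreal (m i)" for i by (simp add: m_def emeasure_eq_measure)
  have em_space: "emeasure \<mu> (space \<mu>) = ennreal B" by (simp add: B_def emeasure_eq_measure)
  have sum_m: "(\<Sum>i<n. m i) \<le> B"
  proof -
    have "(\<Sum>i<n. m i) = measure \<mu> (\<Union>i<n. E i)"
      unfolding m_def using E disj by (intro finite_measure_finite_Union[symmetric]) auto
    also have "\<dots> \<le> B" unfolding B_def by (rule bounded_measure)
    finally show ?thesis .
  qed
  have kernel: "\<kappa> s z \<ge> 0" if "z \<in> K" for s z
    using K(2) that by (auto simp: \<kappa>_def abs_square_le_1 less_imp_le)
  have x1: "cmod (x i) < 1" if "i < n" for i
  proof -
    have "x i \<in> ball 0 1" using x[OF that] K(2) by blast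
    thus ?thesis by simp
  qed
  \<comment> \<open>The term \<open>\<eta> * B\<close> pays for moving the masses. The second
    \<open>\<eta>\<close> makes the constant positive, as \<open>finite_embedding\<close> requires,
    even when \<open>A\<close> and \<open>B\<close> vanish.\<close>
  have bound': "(\<Sum>i<n. m i * \<kappa> (x i) (x j)) \<le> A + \<eta> * B + \<eta>" if j: "j < n" for j
  proof -
    have "ennreal (\<Sum>i<n. m i * \<kappa> (x i) (x j)) = (\<Sum>i<n. ennreal (\<kappa> (x i) (x j)) * emeasure \<mu> (E i))"
      using kernel[OF x[OF j]] by (simp add: em sum_ennreal m_def flip: ennreal_mult) (simp add: mult.commute)
    also have "\<dots> = (\<integral>\<^sup>+s. (\<Sum>i<n. ennreal (\<kappa> (x i) (x j)) * indicator (E i) s) \<partial>\<mu>)"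
      using E by (intro nn_integral_step[symmetric]) auto
    \<comment> \<open>On \<open>E i\<close> the point \<open>s\<close> is close to
      \<open>x i\<close>, which costs \<open>\<eta>\<close>; off \<open>K\<close> the step function
      is zero. The result is the kernel integral at \<open>x j\<close>, a point of
      \<open>K\<close>.\<close>
    also have "\<dots> \<le> (\<integral>\<^sup>+s. ennreal ((cmod (normalized_kernel (x j) s))\<^sup>2) + ennreal \<eta> \<partial>\<mu>)"
    proof (rule nn_integral_mono)
      fix s
      show "(\<Sum>i<n. ennreal (\<kappa> (x i) (x j)) * indicator (E i) s) \<le>
          ennreal ((cmod (normalized_kernel (x j) s))\<^sup>2) + ennreal \<eta>"
      proof (cases "s \<in> K")
        case True
        then obtain i where i: "i < n" "s \<in> E i" using UN by auto
        have "\<kappa> (x i) (x j) \<le> \<kappa> s (x j) + \<eta>"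
          using d1'[OF True x[OF i(1)] x[OF j]] dist[OF i] by simp
        hence "ennreal (\<kappa> (x i) (x j)) \<le> ennreal (\<kappa> s (x j)) + ennreal \<eta>"
          using kernel[OF x[OF j]] \<eta> by (simp add: ennreal_leI flip: ennreal_plus)
        thus ?thesis using sum_indicator_partition[OF _ disj, of i s] i
          by (simp add: norm_normalized_kernel[OF x1[OF j]] \<kappa>_def)
      next
        case False
        hence "(\<Sum>i<n. ennreal (\<kappa> (x i) (x j)) * indicator (E i) s) = 0"
          using EK by (intro sum.neutral) (auto simp: indicator_def)
        thus ?thesis by simp
      qed
    qed
    also have "\<dots> = (\<integral>\<^sup>+s. ennreal ((cmod (normalized_kernel (x j) s))\<^sup>2) \<partial>\<mu>) + ennreal \<eta> * emeasure \<mu> (space \<mu>)"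
    proof -
      have "normalized_kernel (x j) \<in> borel_measurable \<mu>"
        unfolding normalized_kernel_def measurable_cong_sets[OF sets refl]
        by (intro measurable_restrict_space1) measurable
      thus ?thesis by (subst nn_integral_add) auto
    qed
    also have "\<dots> \<le> ennreal A + ennreal \<eta> * ennreal B"
      unfolding em_space by (intro add_mono bound x j order_refl)
    also have "\<dots> = ennreal (A + \<eta> * B)" using A \<eta> B by (simp add: ennreal_mult)
    finally have "(\<Sum>i<n. m i * \<kappa> (x i) (x j)) \<le> A + \<eta> * B"
      using A \<eta> B by (subst (asm) ennreal_le_iff) auto
    thus ?thesis using \<eta> by simp
  qed
  have fe: "(\<Sum>i<n. m i * (cmod (poly p (x i)))\<^sup>2) \<le> 2 * exp 1 * (A + \<eta> * B + \<eta>) * M"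
    unfolding M_def
  proof (rule finite_embedding)
    show "A + \<eta> * B + \<eta> > 0" using A \<eta> B by (intro add_nonneg_pos) auto
  qed (use x1 bound' in \<open>auto simp: m_def \<kappa>_def\<close>)
  have "(\<integral>\<^sup>+z\<in>K. ennreal ((cmod (poly p z))\<^sup>2) \<partial>\<mu>) \<le>
      (\<integral>\<^sup>+z. (\<Sum>i<n. ennreal ((cmod (poly p (x i)))\<^sup>2 + \<eta>) * indicator (E i) z) \<partial>\<mu>)"
  proof (rule nn_integral_mono)
    fix z
    show "ennreal ((cmod (poly p z))\<^sup>2) * indicator K z \<le>
        (\<Sum>i<n. ennreal ((cmod (poly p (x i)))\<^sup>2 + \<eta>) * indicator (E i) z)"
    proof (cases "z \<in> K")
      case True
      then obtain i where i: "i < n" "z \<in> E i" using UN by auto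
      have "(cmod (poly p z))\<^sup>2 \<le> (cmod (poly p (x i)))\<^sup>2 + \<eta>"
        using d2'[OF True x[OF i(1)]] dist[OF i] by simp
      thus ?thesis using sum_indicator_partition[OF _ disj, of i z] i True
        by (simp add: ennreal_leI)
    qed simp
  qed
  also have "\<dots> = (\<Sum>i<n. ennreal ((cmod (poly p (x i)))\<^sup>2 + \<eta>) * emeasure \<mu> (E i))"
    using E by (intro nn_integral_step) auto
  also have "\<dots> = ennreal (\<Sum>i<n. ((cmod (poly p (x i)))\<^sup>2 + \<eta>) * m i)"
    using \<eta> by (simp add: em sum_ennreal m_def ennreal_mult del: ennreal_plus flip: sum_ennreal)
  also have "\<dots> \<le> ennreal (2 * exp 1 * A * M + e)"
  proof (rule ennreal_leI)
    have "(\<Sum>i<n. ((cmod (poly p (x i)))\<^sup>2 + \<eta>) * m i) =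
        (\<Sum>i<n. m i * (cmod (poly p (x i)))\<^sup>2) + \<eta> * (\<Sum>i<n. m i)"
      by (simp add: algebra_simps sum.distrib sum_distrib_left)
    also have "\<dots> \<le> 2 * exp 1 * (A + \<eta> * B + \<eta>) * M + \<eta> * B"
      using fe sum_m \<eta> by (intro add_mono mult_left_mono) auto
    also have "\<dots> \<le> 2 * exp 1 * A * M + e" using \<eta>_le by (simp add: algebra_simps)
    finally show "(\<Sum>i<n. ((cmod (poly p (x i)))\<^sup>2 + \<eta>) * m i) \<le> 2 * exp 1 * A * M + e" .
  qed
  also have "\<dots> = ennreal (2 * exp 1 * A * M) + ennreal e"
  proof (rule ennreal_plus)
    have "M \<ge> 0" unfolding M_def circle_mean_def
      by (intro Henstock_Kurzweil_Integration.integral_nonneg circle_mean_integrable continuous_intros) auto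
    thus "0 \<le> 2 * exp 1 * A * M" using A by simp
  qed (use e in auto)
  finally show "(\<integral>\<^sup>+z\<in>K. ennreal ((cmod (poly p z))\<^sup>2) \<partial>\<mu>) \<le>
    ennreal (2 * exp 1 * A * circle_mean 1 (\<lambda>z. (cmod (poly p z))\<^sup>2)) + ennreal e"
    by (simp add: M_def)
qed

subsection \<open>Density of the polynomials\<close>

lemma space_circle_measure: "space circle_measure = sphere 0 1"
  by (simp add: circle_measure_def space_restrict_space)

lemma sets_circle_measure: "sets circle_measure = sets (restrict_space borel (sphere 0 1))"
  by (simp add: circle_measure_def)

lemma cis_measurable:
  "(\<lambda>t. cis (2 * pi * t)) \<in> restrict_space lborel {0..1} \<rightarrow>\<^sub>M restrict_space borel (sphere 0 1)"
proof (rule measurable_restrict_space2)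
  show "(\<lambda>t. cis (2 * pi * t)) \<in> borel_measurable (restrict_space lborel {0..1})"
    by (intro measurable_restrict_space1)
       (simp add: borel_measurable_continuous_onI continuous_intros)
qed auto

lemma emeasure_circle_measure: "emeasure circle_measure (space circle_measure) = 1"
proof -
  have "emeasure circle_measure (space circle_measure) = emeasure (restrict_space lborel {0..1::real}) {0..1}"
    unfolding space_circle_measure unfolding circle_measure_def
    by (subst emeasure_distr[OF cis_measurable])
       (auto simp: space_restrict_space sets_restrict_space intro!: arg_cong2[where f = emeasure])
  also have "\<dots> = 1" by (subst emeasure_restrict_space) auto
  finally show ?thesis .
qed

interpretation circle: finite_measure circle_measure
  by (rule finite_measureI) (simp add: emeasure_circle_measure)

lemma measure_circle_measure: "measure circle_measure (space circle_measure) = 1"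
  by (simp add: measure_def emeasure_circle_measure)

lemma borel_measurable_circle:
  "f \<in> borel_measurable borel \<Longrightarrow> f \<in> borel_measurable circle_measure"
  unfolding measurable_cong_sets[OF sets_circle_measure refl] by (rule measurable_restrict_space1)

lemma integral_circle_measure:
  fixes h :: "complex \<Rightarrow> real"
  assumes h: "continuous_on UNIV h"
  shows "(\<integral>w. h w \<partial>circle_measure) = circle_mean 1 h"
proof -
  have hm: "h \<in> borel_measurable (restrict_space borel (sphere 0 1))"
    by (intro measurable_restrict_space1 borel_measurable_continuous_onI h)
  have "(\<integral>w. h w \<partial>circle_measure) = (\<integral>t. h (cis (2 * pi * t)) \<partial>restrict_space lborel {0..1})"
    unfolding circle_measure_def by (rule integral_distr[OF cis_measurable hm])
  also have "\<dots> = (LINT t:{0..1}|lborel. h (cis (2 * pi * t)))"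
    unfolding set_lebesgue_integral_def by (rule integral_restrict_space) simp
  also have "\<dots> = integral {0..1} (\<lambda>t. h (cis (2 * pi * t)))"
    by (intro set_borel_integral_eq_integral(2) borel_integrable_atLeastAtMost'
          continuous_on_compose2[OF h]) (auto intro!: continuous_intros)
  finally show ?thesis by (simp add: circle_mean_def)
qed

lemma integrable_circle_continuous:
  fixes h :: "complex \<Rightarrow> 'a::{banach, second_countable_topology}"
  assumes h: "continuous_on UNIV h"
  shows "integrable circle_measure h"
proof -
  have "compact (h ` sphere 0 1)"
    by (intro compact_continuous_image continuous_on_subset[OF h]) auto
  then obtain B where "\<And>w. w \<in> sphere 0 1 \<Longrightarrow> norm (h w) \<le> B"
    using compact_imp_bounded bounded_iff by (metis imageI)
  thus ?thesis
    by (intro circle.integrable_const_bound[of _ B] borel_measurable_circle borel_measurable_continuous_onI h)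
       (auto simp: space_circle_measure)
qed

lemma poly_in_L2_circle: "poly p \<in> L2_circle"
  unfolding L2_circle_def
  by (auto intro!: integrable_circle_continuous borel_measurable_circle borel_measurable_continuous_onI continuous_intros)

lemma L2_circle_norm_poly: "(L2_circle_norm (poly p))\<^sup>2 = circle_mean 1 (\<lambda>z. (cmod (poly p z))\<^sup>2)"
proof -
  have "(L2_circle_norm (poly p))\<^sup>2 = (\<integral>w. (cmod (poly p w))\<^sup>2 \<partial>circle_measure)"
    unfolding L2_circle_norm_def by (intro real_sqrt_pow2 Bochner_Integration.integral_nonneg) auto
  thus ?thesis by (subst (asm) integral_circle_measure) (auto intro!: continuous_intros)
qed

lemma L2_circle_integrable:
  assumes "g \<in> L2_circle"
  shows "integrable circle_measure g"
proof (rule Bochner_Integration.integrable_bound)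
  show "integrable circle_measure (\<lambda>w. 1 + (cmod (g w))\<^sup>2)" "g \<in> borel_measurable circle_measure"
    using assms by (auto simp: L2_circle_def)
  have "cmod (g w) \<le> 1 + (cmod (g w))\<^sup>2" for w
    using zero_le_power2[of "cmod (g w) - 1 / 2"] by (simp add: power2_eq_square algebra_simps)
  thus "AE w in circle_measure. norm (g w) \<le> norm (1 + (cmod (g w))\<^sup>2)" by (simp add: add_nonneg_nonneg)
qed

lemma L2_circle_norm_squared:
  "(L2_circle_norm g)\<^sup>2 = (\<integral>w. (cmod (g w))\<^sup>2 \<partial>circle_measure)"
  unfolding L2_circle_norm_def by (intro real_sqrt_pow2 Bochner_Integration.integral_nonneg) auto

text \<open>Young's inequality with a free parameter, used in place of Minkowski's: the factor of
  the main term can tend to 1 while the large factor meets an error that is quadratically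
  small.\<close>

lemma cmod_diff_squared_le:
  assumes "\<epsilon> > 0"
  shows "(cmod (x - y))\<^sup>2 \<le> (1 + \<epsilon>) * (cmod x)\<^sup>2 + (1 + 1 / \<epsilon>) * (cmod y)\<^sup>2"
proof -
  have "(cmod (x - y))\<^sup>2 \<le> (cmod x + cmod y)\<^sup>2"
    by (intro power_mono norm_triangle_ineq4) auto
  also have "\<dots> \<le> (1 + \<epsilon>) * (cmod x)\<^sup>2 + (1 + 1 / \<epsilon>) * (cmod y)\<^sup>2"
  proof -
    have "0 \<le> (\<epsilon> * cmod x - cmod y)\<^sup>2 / \<epsilon>" using assms by simp
    also have "\<dots> = \<epsilon> * (cmod x)\<^sup>2 + (1 / \<epsilon>) * (cmod y)\<^sup>2 - 2 * cmod x * cmod y"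
      using assms by (simp add: power2_eq_square field_simps)
    finally show ?thesis by (simp add: power2_sum algebra_simps)
  qed
  finally show ?thesis .
qed

lemma L2_circle_diff:
  assumes "g \<in> L2_circle" "h \<in> L2_circle"
  shows "(\<lambda>w. g w - h w) \<in> L2_circle"
proof -
  have [measurable]: "g \<in> borel_measurable circle_measure" "h \<in> borel_measurable circle_measure"
    using assms by (auto simp: L2_circle_def)
  have "integrable circle_measure (\<lambda>w. (cmod (g w - h w))\<^sup>2)"
  proof (rule Bochner_Integration.integrable_bound)
    show "integrable circle_measure (\<lambda>w. 2 * (cmod (g w))\<^sup>2 + 2 * (cmod (h w))\<^sup>2)"
      using assms by (auto simp: L2_circle_def)
    show "AE w in circle_measure. norm ((cmod (g w - h w))\<^sup>2) \<le> norm (2 * (cmod (g w))\<^sup>2 + 2 * (cmod (h w))\<^sup>2)"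
      using cmod_diff_squared_le[of 1] by simp
  qed measurable
  thus ?thesis by (simp add: L2_circle_def)
qed

lemma L2_circle_norm_diff_le:
  assumes "g \<in> L2_circle" "h \<in> L2_circle" "\<epsilon> > 0"
  shows "(L2_circle_norm (\<lambda>w. g w - h w))\<^sup>2 \<le> (1 + \<epsilon>) * (L2_circle_norm g)\<^sup>2 + (1 + 1 / \<epsilon>) * (L2_circle_norm h)\<^sup>2"
proof -
  have i: "integrable circle_measure (\<lambda>w. (cmod (g w))\<^sup>2)" "integrable circle_measure (\<lambda>w. (cmod (h w))\<^sup>2)"
    "integrable circle_measure (\<lambda>w. (cmod (g w - h w))\<^sup>2)"
    using assms L2_circle_diff[OF assms(1,2)] by (auto simp: L2_circle_def)
  have "(L2_circle_norm (\<lambda>w. g w - h w))\<^sup>2 \<le>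
      (\<integral>w. (1 + \<epsilon>) * (cmod (g w))\<^sup>2 + (1 + 1 / \<epsilon>) * (cmod (h w))\<^sup>2 \<partial>circle_measure)"
    unfolding L2_circle_norm_squared using i cmod_diff_squared_le[OF assms(3)]
    by (intro integral_mono Bochner_Integration.integrable_add integrable_mult_right) auto
  also have "\<dots> = (1 + \<epsilon>) * (L2_circle_norm g)\<^sup>2 + (1 + 1 / \<epsilon>) * (L2_circle_norm h)\<^sup>2"
    unfolding L2_circle_norm_squared using i by simp
  finally show ?thesis .
qed

text \<open>The variance of \<open>cmod (g w)\<close> under a probability measure is
  nonnegative.\<close>

lemma integral_norm_le_L2_circle_norm:
  assumes "g \<in> L2_circle"
  shows "(\<integral>w. cmod (g w) \<partial>circle_measure) \<le> L2_circle_norm g"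
proof -
  define c where "c = (\<integral>w. cmod (g w) \<partial>circle_measure)"
  have i: "integrable circle_measure (\<lambda>w. (cmod (g w))\<^sup>2)" "integrable circle_measure (\<lambda>w. cmod (g w))"
    using assms L2_circle_integrable[OF assms] by (auto simp: L2_circle_def)
  have "0 \<le> (\<integral>w. (cmod (g w) - c)\<^sup>2 \<partial>circle_measure)"
    by (intro Bochner_Integration.integral_nonneg) auto
  also have "\<dots> = (\<integral>w. (cmod (g w))\<^sup>2 - 2 * c * cmod (g w) + c\<^sup>2 \<partial>circle_measure)"
    by (simp add: power2_diff algebra_simps)
  also have "\<dots> = (\<integral>w. (cmod (g w))\<^sup>2 \<partial>circle_measure) - 2 * c * c + c\<^sup>2"
    using i by (simp add: c_def measure_circle_measure)
  finally have "c\<^sup>2 \<le> (\<integral>w. (cmod (g w))\<^sup>2 \<partial>circle_measure)" by (simp add: power2_eq_square)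
  thus ?thesis unfolding L2_circle_norm_def c_def[symmetric] by (rule real_le_rsqrt)
qed

text \<open>On the circle the Cauchy kernel is bounded by \<open>1 / (1 - cmod z)\<close>, and the
  Cauchy integral reproduces polynomials. Thus approximation in norm on the circle forces pointwise
  convergence in the disc.\<close>

lemma analytic_extension_diff_poly:
  assumes g: "g \<in> L2_circle" and z: "cmod z < 1"
  shows "cmod (analytic_extension g z - poly p z) \<le> L2_circle_norm (\<lambda>w. g w - poly p w) / (1 - cmod z)"
proof -
  define h where "h w = g w - poly p w" for w
  have h: "h \<in> L2_circle" unfolding h_def by (intro L2_circle_diff g poly_in_L2_circle)
  have lb: "1 - cmod z \<le> cmod (1 - z * cnj w)" if "w \<in> space circle_measure" for w
    using norm_triangle_ineq2[of 1 "z * cnj w"] that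
    by (simp add: space_circle_measure norm_mult)
  have ub: "cmod (f w / (1 - z * cnj w)) \<le> cmod (f w) / (1 - cmod z)" 
    if "w \<in> space circle_measure" for w and f :: "complex \<Rightarrow> complex"
    using lb[OF that] z by (simp add: norm_divide frac_le)
  have int: "integrable circle_measure (\<lambda>w. f w / (1 - z * cnj w))" if f: "f \<in> L2_circle" for f
  proof (rule Bochner_Integration.integrable_bound)
    show "integrable circle_measure (\<lambda>w. f w / of_real (1 - cmod z))"
      using L2_circle_integrable[OF f] by simp
    have "(\<lambda>w. 1 - z * cnj w) \<in> borel_measurable circle_measure"
      by (intro borel_measurable_circle borel_measurable_continuous_onI continuous_intros)
    thus "(\<lambda>w. f w / (1 - z * cnj w)) \<in> borel_measurable circle_measure"
      using f by (intro borel_measurable_divide) (auto simp: L2_circle_def)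
    show "AE w in circle_measure. norm (f w / (1 - z * cnj w)) \<le> norm (f w / of_real (1 - cmod z))"
      using ub[of _ f] z by (intro AE_I2) (simp add: norm_divide del: of_real_diff)
  qed
  have "analytic_extension g z - poly p z = analytic_extension g z - analytic_extension (poly p) z"
    by (simp add: analytic_extension_poly z)
  also have "\<dots> = (\<integral>w. h w / (1 - z * cnj w) \<partial>circle_measure)"
    unfolding analytic_extension_def h_def
    by (subst Bochner_Integration.integral_diff[symmetric])
       (auto intro!: int g poly_in_L2_circle simp: diff_divide_distrib)
  also have "cmod \<dots> \<le> (\<integral>w. cmod (h w / (1 - z * cnj w)) \<partial>circle_measure)"
    by (rule integral_norm_bound)
  also have "\<dots> \<le> (\<integral>w. cmod (h w) / (1 - cmod z) \<partial>circle_measure)"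
    using ub[of _ h] L2_circle_integrable[OF h] int[OF h] by (intro integral_mono) auto
  also have "\<dots> = (\<integral>w. cmod (h w) \<partial>circle_measure) / (1 - cmod z)" by simp
  also have "\<dots> \<le> L2_circle_norm h / (1 - cmod z)"
    using z by (intro divide_right_mono integral_norm_le_L2_circle_norm h) auto
  finally show ?thesis by (simp add: h_def[abs_def])
qed

text \<open>In the disc the denominator of the kernel has modulus at most 2, so the squared kernel
  is bounded below by (1 - |l|^2) / 4.\<close>

lemma finite_measure_of_kernel_integral:
  fixes \<mu> :: "complex measure"
  assumes space: "space \<mu> = ball 0 1" and l: "cmod l < 1"
    and bound: "(\<integral>\<^sup>+z. ennreal ((cmod (normalized_kernel l z))\<^sup>2) \<partial>\<mu>) < \<infinity>"
  shows "finite_measure \<mu>"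
proof (rule finite_measureI)
  define c where "c = (1 - (cmod l)\<^sup>2) / 4"
  have c: "c > 0" using l by (simp add: c_def abs_square_less_1)
  have "ennreal c * emeasure \<mu> (space \<mu>) = (\<integral>\<^sup>+z. ennreal c \<partial>\<mu>)" by simp
  also have "\<dots> \<le> (\<integral>\<^sup>+z. ennreal ((cmod (normalized_kernel l z))\<^sup>2) \<partial>\<mu>)"
  proof (intro nn_integral_mono ennreal_leI)
    fix z assume "z \<in> space \<mu>"
    hence z: "cmod z < 1" by (simp add: space)
    have nz: "1 - cnj z * l \<noteq> 0" using one_minus_mult_cnj_nonzero(1)[of z l] z l by simp
    have "cmod (1 - cnj z * l) \<le> 1 + cmod z * cmod l"
      using norm_triangle_ineq4[of 1 "cnj z * l"] by (simp add: norm_mult)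
    also have "\<dots> \<le> 1 + 1 * 1" using z l by (intro add_mono mult_mono) auto
    finally have "(cmod (1 - cnj z * l))\<^sup>2 \<le> 2\<^sup>2" by (intro power_mono) auto
    thus "c \<le> (cmod (normalized_kernel l z))\<^sup>2"
      unfolding norm_normalized_kernel[OF l] c_def using nz l
      by (intro divide_left_mono) (auto simp: abs_square_le_1)
  qed
  finally have "ennreal c * emeasure \<mu> (space \<mu>) < \<infinity>" using bound by (rule le_less_trans)
  thus "emeasure \<mu> (space \<mu>) \<noteq> \<infinity>" using c by (auto simp: ennreal_mult_top)
qed

text \<open>Choose \<open>P n\<close> at distance less than \<epsilon> = 1 / (n + 1) from
  \<open>f\<close> and write it as \<open>f\<close> minus the error. With the same \<epsilon> as
  parameter in \<open>L2_circle_norm_diff_le\<close>, the error contributes at most (1 + 1 /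
  \<epsilon>) \<epsilon>^2, which tends to 0.\<close>

lemma hardy_H2_approx:
  assumes "f \<in> hardy_H2"
  obtains P where "\<And>n. (L2_circle_norm (poly (P n)))\<^sup>2 \<le>
      (1 + 1 / Suc n) * (L2_circle_norm f)\<^sup>2 + (1 + real (Suc n)) / (real (Suc n))\<^sup>2"
    "\<And>z. cmod z < 1 \<Longrightarrow> (\<lambda>n. poly (P n) z) \<longlonglongrightarrow> analytic_extension f z"
proof -
  have f: "f \<in> L2_circle" using assms by (simp add: hardy_H2_def)
  have "\<forall>n. \<exists>p. L2_circle_norm (\<lambda>w. f w - poly p w) < 1 / Suc n"
    using assms by (auto simp: hardy_H2_def)
  then obtain P where P: "\<And>n. L2_circle_norm (\<lambda>w. f w - poly (P n) w) < 1 / Suc n" by metis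
  show ?thesis
  proof
    fix n
    define g where "g w = f w - poly (P n) w" for w
    have g: "g \<in> L2_circle" unfolding g_def by (intro L2_circle_diff f poly_in_L2_circle)
    have "0 \<le> L2_circle_norm g"
      unfolding L2_circle_norm_def by (intro real_sqrt_ge_zero Bochner_Integration.integral_nonneg) auto
    hence "(L2_circle_norm g)\<^sup>2 \<le> (1 / Suc n)\<^sup>2"
      using P[of n] by (intro power_mono) (auto simp: g_def[abs_def])
    hence "(1 + real (Suc n)) * (L2_circle_norm g)\<^sup>2 \<le> (1 + real (Suc n)) * (1 / Suc n)\<^sup>2"
      by (intro mult_left_mono) auto
    moreover have "(L2_circle_norm (\<lambda>w. f w - g w))\<^sup>2 \<le>
        (1 + 1 / Suc n) * (L2_circle_norm f)\<^sup>2 + (1 + 1 / (1 / Suc n)) * (L2_circle_norm g)\<^sup>2"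
      by (rule L2_circle_norm_diff_le[OF f g]) auto
    ultimately show "(L2_circle_norm (poly (P n)))\<^sup>2 \<le>
        (1 + 1 / Suc n) * (L2_circle_norm f)\<^sup>2 + (1 + real (Suc n)) / (real (Suc n))\<^sup>2"
      by (simp add: g_def power_divide)
  next
    fix z assume z: "cmod z < 1"
    have "(\<lambda>n. poly (P n) z - analytic_extension f z) \<longlonglongrightarrow> 0"
    proof (rule Lim_null_comparison)
      have "cmod (poly (P n) z - analytic_extension f z) \<le> (1 / Suc n) / (1 - cmod z)" for n
      proof -
        have "cmod (poly (P n) z - analytic_extension f z) \<le> L2_circle_norm (\<lambda>w. f w - poly (P n) w) / (1 - cmod z)"
          using analytic_extension_diff_poly[OF f z, of "P n"] by (simp add: norm_minus_commute)
        also have "\<dots> \<le> (1 / Suc n) / (1 - cmod z)"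
          using P[of n] z by (intro divide_right_mono) auto
        finally show ?thesis .
      qed
      thus "\<forall>\<^sub>F n in sequentially. norm (poly (P n) z - analytic_extension f z) \<le> (1 / Suc n) / (1 - cmod z)"
        by simp
      show "(\<lambda>n. (1 / real (Suc n)) / (1 - cmod z)) \<longlonglongrightarrow> 0"
        by (rule tendsto_divide_zero) (rule LIMSEQ_Suc, rule lim_1_over_n)
    qed
    thus "(\<lambda>n. poly (P n) z) \<longlonglongrightarrow> analytic_extension f z" by (rule LIM_zero_cancel)
  qed
qed

section \<open>Passage to the limit from polynomials on compact sets\<close>

theorem theorem0p2:
  fixes \<mu> :: "complex measure" and A :: ennreal
  assumes borel: "sets \<mu> = sets (restrict_space borel (ball 0 1))"
    and A_def: "A = (SUP l\<in>closed_support \<mu>. \<integral>\<^sup>+z. ennreal ((cmod (normalized_kernel l z))\<^sup>2) \<partial>\<mu>)"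
    and A_finite: "A < \<infinity>"
  shows "\<forall>f\<in>hardy_H2. (\<integral>\<^sup>+z. ennreal ((cmod (analytic_extension f z))\<^sup>2) \<partial>\<mu>)
           \<le> ennreal (2 * exp 1) * A * ennreal ((L2_circle_norm f)\<^sup>2)"
proof
  fix f assume f: "f \<in> hardy_H2"
  let ?S = "closed_support \<mu>"
  have space: "space \<mu> = ball 0 1"
    using sets_eq_imp_space_eq[OF borel] by (simp add: space_restrict_space)
  have S_sub: "?S \<subseteq> ball 0 1" by (auto simp: closed_support_def space)
  have null: "space \<mu> - ?S \<in> null_sets \<mu>"
    by (rule null_sets_closed_support_complement)
       (auto simp: borel sets_restrict_space_iff space)
  hence AE_S: "AE z in \<mu>. z \<in> ?S" by (rule AE_I') auto
  have bound: "(\<integral>\<^sup>+z. ennreal ((cmod (normalized_kernel l z))\<^sup>2) \<partial>\<mu>) \<le> A" if "l \<in> ?S" for l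
    unfolding A_def using that by (rule SUP_upper)
  have fin: "finite_measure \<mu>"
  \<comment> \<open>With empty support the whole disc is a null set; otherwise any point of the
    support supplies a finite kernel integral.\<close>
  proof (cases "?S = {}")
    case True
    thus ?thesis using null by (intro finite_measureI) auto
  next
    case False
    then obtain l where l: "l \<in> ?S" by blast
    show ?thesis
      by (rule finite_measure_of_kernel_integral[OF space, of l])
         (use l S_sub le_less_trans[OF bound[OF l] A_finite] in auto)
  qed
  define a where "a = enn2real A"
  have a: "A = ennreal a" "a \<ge> 0" using A_finite by (simp_all add: a_def)
  define K where "K n = ?S \<inter> cball 0 (1 - 1 / Suc n)" for n :: nat
  have K: "compact (K n)" "K n \<subseteq> ball 0 1" "K n \<in> sets \<mu>" for n
  proof -
    obtain W where W: "open W" "space \<mu> - ?S = W \<inter> space \<mu>"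
      by (rule closed_support_complement_open)
    have sub: "cball 0 (1 - 1 / real (Suc n)) \<subseteq> ball (0::complex) 1"
    proof -
      have "1 - 1 / real (Suc n) < 1" by simp
      thus ?thesis by (simp only: cball_subset_ball_iff dist_self) simp
    qed
    \<comment> \<open>The support is closed only relative to the disc. Inside a smaller closed ball
      it is that ball minus an open set, hence compact.\<close>
    have "K n = cball 0 (1 - 1 / Suc n) - W"
      using W(2) S_sub sub unfolding K_def space by blast
    thus "compact (K n)" using W(1) by (simp add: compact_diff)
    show "K n \<subseteq> ball 0 1" using sub by (auto simp: K_def)
    thus "K n \<in> sets \<mu>" using borel_compact[OF \<open>compact (K n)\<close>]
      by (simp add: borel sets_restrict_space_iff)
  qed
  obtain P where P: "\<And>n. (L2_circle_norm (poly (P n)))\<^sup>2 \<le>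
      (1 + 1 / Suc n) * (L2_circle_norm f)\<^sup>2 + (1 + real (Suc n)) / (real (Suc n))\<^sup>2"
    and lim: "\<And>z. cmod z < 1 \<Longrightarrow> (\<lambda>n. poly (P n) z) \<longlonglongrightarrow> analytic_extension f z"
    using hardy_H2_approx[OF f] by blast
  \<comment> \<open>One index drives both the polynomial and the compact set. At each point of the
    support the indicator is eventually 1, so \<open>h n\<close> has the desired pointwise limit
    there.\<close>
  define h where "h n z = ennreal ((cmod (poly (P n) z))\<^sup>2) * indicator (K n) z" for n z
  define c where "c n = 2 * exp 1 * a * ((1 + 1 / Suc n) * (L2_circle_norm f)\<^sup>2 + (1 + real (Suc n)) / (real (Suc n))\<^sup>2)" for n :: nat
  have h_le: "integral\<^sup>N \<mu> (h n) \<le> ennreal (c n)" for n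
  proof -
    have "integral\<^sup>N \<mu> (h n) \<le> ennreal (2 * exp 1 * a * circle_mean 1 (\<lambda>z. (cmod (poly (P n) z))\<^sup>2))"
      unfolding h_def
      by (rule poly_embedding_compact[OF borel fin K(1,2) a(2)])
         (use bound a in \<open>auto simp: K_def\<close>)
    also have "\<dots> \<le> ennreal (c n)"
      unfolding c_def L2_circle_norm_poly[symmetric] using a(2)
      by (intro ennreal_leI mult_left_mono P) auto
    finally show ?thesis .
  qed
  have lim_h: "(\<lambda>n. h n z) \<longlonglongrightarrow> ennreal ((cmod (analytic_extension f z))\<^sup>2)" if z: "z \<in> ?S" for z
  proof -
    have z1: "cmod z < 1" using z S_sub by auto
    have "(\<lambda>n. ennreal ((cmod (poly (P n) z))\<^sup>2)) \<longlonglongrightarrow> ennreal ((cmod (analytic_extension f z))\<^sup>2)"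
      by (intro tendsto_ennrealI tendsto_intros lim z1)
    moreover have "\<forall>\<^sub>F n in sequentially. ennreal ((cmod (poly (P n) z))\<^sup>2) = h n z"
    proof -
      have "(\<lambda>n. 1 - 1 / real (Suc n)) \<longlonglongrightarrow> 1 - 0"
        by (intro tendsto_diff tendsto_const LIMSEQ_Suc[OF lim_1_over_n])
      hence "\<forall>\<^sub>F n in sequentially. cmod z < 1 - 1 / real (Suc n)"
        using z1 by (auto dest!: order_tendstoD(1)[of _ _ _ "cmod z"])
      thus ?thesis by eventually_elim (use z in \<open>auto simp: h_def K_def\<close>)
    qed
    ultimately show ?thesis by (rule Lim_transform_eventually)
  qed
  have hm: "h n \<in> borel_measurable \<mu>" for n
  proof -
    have "poly (P n) \<in> borel_measurable \<mu>"
      unfolding measurable_cong_sets[OF borel refl]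
      by (intro measurable_restrict_space1 borel_measurable_continuous_onI continuous_intros)
    thus ?thesis unfolding h_def using K(3)[of n] by measurable
  qed
  \<comment> \<open>The support has full measure, so the limit holds almost everywhere and Fatou's
    lemma passes the bounds \<open>c n\<close> to \<open>f\<close>.\<close>
  have "(\<integral>\<^sup>+z. ennreal ((cmod (analytic_extension f z))\<^sup>2) \<partial>\<mu>) = (\<integral>\<^sup>+z. liminf (\<lambda>n. h n z) \<partial>\<mu>)"
    by (rule nn_integral_cong_AE) (use AE_S in \<open>auto elim!: eventually_mono dest!: lim_h simp: lim_imp_Liminf\<close>)
  also have "\<dots> \<le> liminf (\<lambda>n. integral\<^sup>N \<mu> (h n))" by (rule nn_integral_liminf[OF hm])
  also have "\<dots> \<le> liminf (\<lambda>n. ennreal (c n))" by (intro Liminf_mono always_eventually allI h_le)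
  also have "\<dots> = ennreal (2 * exp 1 * a * ((1 + 0) * (L2_circle_norm f)\<^sup>2 + 0))"
  proof (intro lim_imp_Liminf tendsto_ennrealI)
    have "(\<lambda>n. 1 / real (Suc n)) \<longlonglongrightarrow> 0" by (rule LIMSEQ_Suc[OF lim_1_over_n])
    moreover have "(\<lambda>n. (1 + real (Suc n)) / (real (Suc n))\<^sup>2) \<longlonglongrightarrow> 0" 
      by real_asymp
    ultimately show "c \<longlonglongrightarrow> 2 * exp 1 * a * ((1 + 0) * (L2_circle_norm f)\<^sup>2 + 0)"
      unfolding c_def by (intro tendsto_intros)
  qed simp
  also have "\<dots> = ennreal (2 * exp 1) * A * ennreal ((L2_circle_norm f)\<^sup>2)"
    using a by (simp add: ennreal_mult)
  finally show "(\<integral>\<^sup>+z. ennreal ((cmod (analytic_extension f z))\<^sup>2) \<partial>\<mu>)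
      \<le> ennreal (2 * exp 1) * A * ennreal ((L2_circle_norm f)\<^sup>2)" .
qed

end
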